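(* Let $n,k\ge1$. The orbits of rowmotion on the extended comb $C_{n,k}$ can be partitioned into two sets $\mathcal{S}$ and $\mathcal{L}$ when $k$ is odd, and into $n+1$ sets $\mathcal{S}_1,\mathcal{S}_2,\dots,\mathcal{S}_n$ and $\mathcal{L}$ when $k$ is even, with the following properties. If $k$ is odd: - $\mathcal{S}$ contains $2^{n-1}$ orbits, and each $\mathcal{O}\in\mathcal{S}$ satisfies $\#\mathcal{O}=2$, $\chi(\mathcal{O})=n+1$, and $\hat\chi(\mathcal{O})=(2k+1)n-2k+3$. - $\mathcal{L}$ contains $1$ orbit, and it satisfies $\#\mathcal{O}=(k+1)2^n-2k+1$, $\chi(\mathcal{O})=((k+1)n+1)2^{n-1}-k+1$, and $\hat\chi(\mathcal{O})=(2k+1)(k+1)n2^{n-1}-(5k^2+3k-3)2^{n-1}+3k^2$. If $k$ is even: - For each $i\in\{1,\dots,n\}$, $\mathcal{S}_i$ contains $2^{n-i}$ orbits, and each $\mathcal{O}\in\mathcal{S}_i$ satisfies $\#\mathcal{O}=k(i-1)+2$, $$\chi(\mathcal{O})=\frac{k(i-1)+2}{2}n-\frac k4(i^2-5i+4)+1,$$ $$\hat\chi(\mathcal{O})=\frac{(2k+1)(k(i-1)+2)}{2}n-\frac{k(2k+1)}4i^2+\frac{3k}4i+\binom{k-2}{2}.$$ - $\mathcal{L}$ contains $1$ orbit, and it satisfies $\#\mathcal{O}=k(n-1)+3$, $$\chi(\mathcal{O})=\frac k4n^2+\frac{3k+4}4n-k+2,$$ $$\hat\chi(\mathcal{O})=\frac{k(2k+1)}4n^2-\frac{4k^2-9k-4}4n+\binom{k-2}{2}.$$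 Thus $\chi$ and $\hat\chi$ are homometric on $C_{n,k}$.
   Context: For a finite poset $P$, let $\mathcal{A}(P)$ be its set of antichains, and for $Q\subseteq P$ let $Q{\downarrow}=\{x\in P: x\le y\text{ for some }y\in Q\}$. Rowmotion on antichains is the bijection $\rho(A)=\min\{x\in P: x\notin A{\downarrow}\}$ of $\mathcal{A}(P)$; rowmotion on lower order ideals is $\hat\rho(L)=\rho(\max L){\downarrow}$. The map $A\mapsto A{\downarrow}$ carries antichain orbits to ideal orbits. Orbits $\mathcal{O}$ are antichain orbits; $\chi(\mathcal{O})=\sum_{A\in\mathcal{O}}\#A$ and $\hat\chi(\mathcal{O})=\sum_{A\in\mathcal{O}}\#(A{\downarrow})$. A statistic $\mathrm{st}$ is homometric if $\mathrm{st}(\mathcal{O}_1)=\mathrm{st}(\mathcal{O}_2)$ for any two orbits with $\#\mathcal{O}_1=\#\mathcal{O}_2$. The extended comb $C_{n,k}$ is the rooted tree (poset with unique minimal element whose Hasse diagram is a tree) with $n+1$ leaves (maximal elements) labeled $1,\dots,n+1$, whose non-leaf elements form the disjoint union of chains $B_{n+1},B_n,\dots,B_2$, where $B_m$ is the set of elements whose set of leaves above them is exactly $\{1,\dots,m\}$, with $\#B_{n+1}=1$ (so $B_{n+1}=\{\hat0\}$, the root) and $\#B_m=k$ for $2\le m\le n$. Explicitly, for $3\le m\le n+1$ the maximum of $B_m$ is covered by exactly the minimum of $B_{m-1}$ and the leaf $m$; and the maximum of $B_2$ is covered by exactly the leaves $1$ and $2$. Here $\binom{k-2}{2}=(k-2)(k-3)/2$.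 *)

theory Defs
  imports Complex_Main "HOL-Library.Disjoint_Sets" "HOL-Combinatorics.Orbits"
begin

section \<open>Rowmotion on the antichains of a finite poset\<close>

text \<open>A poset is a carrier \<open>P\<close> with a relation \<open>r\<close> such that \<open>partial_order_on P r\<close>;
  \<open>(x, y) \<in> r\<close> means \<open>x \<le> y\<close>.\<close>

definition antichains :: "'a set \<Rightarrow> 'a rel \<Rightarrow> 'a set set" where
  "antichains P r = {A. A \<subseteq> P \<and> (\<forall>x\<in>A. \<forall>y\<in>A. (x, y) \<in> r \<longrightarrow> x = y)}"

definition down_closure :: "'a set \<Rightarrow> 'a rel \<Rightarrow> 'a set \<Rightarrow> 'a set" where
  "down_closure P r Q = {x \<in> P. \<exists>y\<in>Q. (x, y) \<in> r}"

definition minimal_elements :: "'a rel \<Rightarrow> 'a set \<Rightarrow> 'a set" where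
  "minimal_elements r Q = {x \<in> Q. \<forall>y\<in>Q. (y, x) \<in> r \<longrightarrow> y = x}"

definition rowmotion :: "'a set \<Rightarrow> 'a rel \<Rightarrow> 'a set \<Rightarrow> 'a set" where
  "rowmotion P r A = minimal_elements r {x \<in> P. x \<notin> down_closure P r A}"

text \<open>The library's \<^const>\<open>orbit\<close> collects forward iterates \<open>f x, f (f x), \<dots>\<close>. This is the
  usual orbit because rowmotion permutes the finite set of antichains
  (\<open>bij_betw_rowmotion\<close> below).\<close>

definition rowmotion_orbits :: "'a set \<Rightarrow> 'a rel \<Rightarrow> 'a set set set" where
  "rowmotion_orbits P r = orbit (rowmotion P r) ` antichains P r"

definition chi :: "'a set set \<Rightarrow> nat" where
  "chi X = (\<Sum>A\<in>X. card A)"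

definition chi_hat :: "'a set \<Rightarrow> 'a rel \<Rightarrow> 'a set set \<Rightarrow> nat" where
  "chi_hat P r X = (\<Sum>A\<in>X. card (down_closure P r A))"

definition homometric :: "'a set \<Rightarrow> 'a rel \<Rightarrow> ('a set set \<Rightarrow> 'b) \<Rightarrow> bool" where
  "homometric P r st \<longleftrightarrow>
    (\<forall>X\<in>rowmotion_orbits P r. \<forall>Y\<in>rowmotion_orbits P r. card X = card Y \<longrightarrow> st X = st Y)"

lemma ex_minimal_below:
  assumes "finite P" "partial_order_on P r" "Q \<subseteq> P" "x \<in> Q"
  shows "\<exists>m\<in>minimal_elements r Q. (m, x) \<in> r"
proof -
  have tr: "trans r" and an: "antisym r" and rf: "refl_on P r"
    using assms(2) by (auto simp: partial_order_on_def preorder_on_def)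
  let ?D = "\<lambda>x. {y \<in> Q. (y, x) \<in> r}"
  have fin: "finite (?D x)" for x
    using assms(1,3) by (auto intro: finite_subset)
  show ?thesis
    using assms(4)
  proof (induction "card (?D x)" arbitrary: x rule: less_induct)
    case less
    show ?case
    proof (cases "x \<in> minimal_elements r Q")
      case True
      then show ?thesis
        using less.prems assms(3) rf by (auto simp: refl_on_def)
    next
      case False
      then obtain y where y: "y \<in> Q" "(y, x) \<in> r" "y \<noteq> x"
        using less.prems by (auto simp: minimal_elements_def)
      have "?D y \<subseteq> ?D x"
        using y(2) tr by (auto dest: transD)
      moreover have "x \<in> ?D x" "x \<notin> ?D y"
        using less.prems assms(3) rf y an by (auto simp: refl_on_def dest: antisymD)
      ultimately have "?D y \<subset> ?D x"
        by blast
      then have "card (?D y) < card (?D x)"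
        using fin by (intro psubset_card_mono)
      then obtain m where "m \<in> minimal_elements r Q" "(m, y) \<in> r"
        using less.hyps y(1) by blast
      then show ?thesis
        using y(2) tr by (auto dest: transD)
    qed
  qed
qed

lemma finite_antichains: "finite P \<Longrightarrow> finite (antichains P r)"
  by (rule finite_subset[of _ "Pow P"]) (auto simp: antichains_def)

lemma rowmotion_in_antichains: "rowmotion P r A \<in> antichains P r"
  by (auto simp: rowmotion_def antichains_def minimal_elements_def)

lemma bij_betw_rowmotion:
  assumes "finite P" "partial_order_on P r"
  shows "bij_betw (rowmotion P r) (antichains P r) (antichains P r)"
proof -
  have tr: "trans r" and an: "antisym r" and rf: "refl_on P r"
    using assms(2) by (auto simp: partial_order_on_def preorder_on_def)
  have compl: "P - down_closure P r A = {x \<in> P. \<exists>m\<in>rowmotion P r A. (m, x) \<in> r}" for A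
  proof (intro equalityI subsetI)
    fix x assume "x \<in> P - down_closure P r A"
    then show "x \<in> {x \<in> P. \<exists>m\<in>rowmotion P r A. (m, x) \<in> r}"
      using ex_minimal_below[OF assms, of "{x \<in> P. x \<notin> down_closure P r A}" x]
      by (auto simp: rowmotion_def)
  next
    fix x assume "x \<in> {x \<in> P. \<exists>m\<in>rowmotion P r A. (m, x) \<in> r}"
    then show "x \<in> P - down_closure P r A"
      using tr by (auto simp: rowmotion_def minimal_elements_def down_closure_def dest: transD)
  qed
  have sub: "A \<subseteq> B"
    if A: "A \<in> antichains P r" and B: "B \<in> antichains P r"
      and eq: "down_closure P r A = down_closure P r B" for A B
  proof
    fix x assume x: "x \<in> A"
    then have xP: "x \<in> P" "(x, x) \<in> r"
      using A rf by (auto simp: antichains_def refl_on_def)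
    then have "x \<in> down_closure P r A"
      using x by (auto simp: down_closure_def)
    then have "x \<in> down_closure P r B"
      by (simp add: eq)
    then obtain y where y: "y \<in> B" "(x, y) \<in> r"
      by (auto simp: down_closure_def)
    then have "y \<in> P" "(y, y) \<in> r"
      using B rf by (auto simp: antichains_def refl_on_def)
    then have "y \<in> down_closure P r B"
      using y by (auto simp: down_closure_def)
    then have "y \<in> down_closure P r A"
      by (simp add: eq)
    then obtain z where z: "z \<in> A" "(y, z) \<in> r"
      by (auto simp: down_closure_def)
    then have "x = z"
      using A x transD[OF tr y(2) z(2)] by (auto simp: antichains_def)
    then show "x \<in> B"
      using y z an by (auto dest: antisymD)
  qed
  have "inj_on (rowmotion P r) (antichains P r)"
  proof (rule inj_onI)
    fix A B assume A: "A \<in> antichains P r" and B: "B \<in> antichains P r"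
      and "rowmotion P r A = rowmotion P r B"
    then have "P - down_closure P r A = P - down_closure P r B"
      by (simp add: compl)
    then have "down_closure P r A = down_closure P r B"
      by (auto simp: down_closure_def)
    then show "A = B"
      using sub A B by (simp add: subset_antisym)
  qed
  moreover from this have "rowmotion P r ` antichains P r = antichains P r"
    using finite_antichains[OF assms(1)] rowmotion_in_antichains
    by (intro endo_inj_surj) auto
  ultimately show ?thesis
    by (simp add: bij_betw_def)
qed


section \<open>The extended comb\<close>

text \<open>\<open>Leaf i\<close> is the leaf labelled \<open>i\<close>, and \<open>Spine m j\<close> is the \<open>j\<close>-th element from below of
  the chain \<open>B\<^sub>m\<close>, counting from \<open>1\<close>.\<close>

datatype comb_elt = Leaf nat | Spine nat nat

definition spine_length :: "nat \<Rightarrow> nat \<Rightarrow> nat \<Rightarrow> nat" where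
  "spine_length n k m = (if m = n + 1 then 1 else k)"

definition spine_chain :: "nat \<Rightarrow> nat \<Rightarrow> nat \<Rightarrow> comb_elt set" where
  "spine_chain n k m = Spine m ` {1..spine_length n k m}"

definition comb :: "nat \<Rightarrow> nat \<Rightarrow> comb_elt set" where
  "comb n k = Leaf ` {1..n+1} \<union> (\<Union>m\<in>{2..n+1}. spine_chain n k m)"

text \<open>\<open>(x, y) \<in> comb_covers n k\<close> means that \<open>x\<close> is covered by \<open>y\<close>.\<close>

inductive_set comb_covers :: "nat \<Rightarrow> nat \<Rightarrow> comb_elt rel" for n k where
  chain: "2 \<le> m \<Longrightarrow> m \<le> n + 1 \<Longrightarrow> 1 \<le> j \<Longrightarrow> j < spine_length n k m \<Longrightarrow>
    (Spine m j, Spine m (Suc j)) \<in> comb_covers n k"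
| spine: "3 \<le> m \<Longrightarrow> m \<le> n + 1 \<Longrightarrow>
    (Spine m (spine_length n k m), Spine (m - 1) 1) \<in> comb_covers n k"
| tooth: "3 \<le> m \<Longrightarrow> m \<le> n + 1 \<Longrightarrow>
    (Spine m (spine_length n k m), Leaf m) \<in> comb_covers n k"
| leaf1: "(Spine 2 (spine_length n k 2), Leaf 1) \<in> comb_covers n k"
| leaf2: "(Spine 2 (spine_length n k 2), Leaf 2) \<in> comb_covers n k"

definition comb_order :: "nat \<Rightarrow> nat \<Rightarrow> comb_elt rel" where
  "comb_order n k = (comb_covers n k)\<^sup>* \<inter> comb n k \<times> comb n k"

fun comb_le :: "comb_elt \<Rightarrow> comb_elt \<Rightarrow> bool" where
  "comb_le (Leaf i) y \<longleftrightarrow> y = Leaf i"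
| "comb_le (Spine m j) (Leaf i) \<longleftrightarrow> i \<le> m"
| "comb_le (Spine m j) (Spine m' j') \<longleftrightarrow> m' < m \<or> m' = m \<and> j \<le> j'"

lemma finite_comb: "finite (comb n k)"
  by (simp add: comb_def spine_chain_def)

lemma Leaf_in_comb [simp]: "Leaf i \<in> comb n k \<longleftrightarrow> 1 \<le> i \<and> i \<le> n + 1"
  by (auto simp: comb_def spine_chain_def)

lemma Spine_in_comb [simp]:
  "Spine m j \<in> comb n k \<longleftrightarrow> 2 \<le> m \<and> m \<le> n + 1 \<and> 1 \<le> j \<and> j \<le> spine_length n k m"
  by (auto simp: comb_def spine_chain_def image_iff)

lemma comb_le_refl: "comb_le x x"
  by (cases x) auto

lemma comb_le_trans: "comb_le x y \<Longrightarrow> comb_le y z \<Longrightarrow> comb_le x z"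
  by (cases x; cases y; cases z) auto

lemma comb_le_antisym: "comb_le x y \<Longrightarrow> comb_le y x \<Longrightarrow> x = y"
  by (cases x; cases y) auto

lemma comb_le_if_covers_rtrancl: "(x, y) \<in> (comb_covers n k)\<^sup>* \<Longrightarrow> comb_le x y"
  by (induction rule: rtrancl_induct)
    (auto intro: comb_le_refl elim!: comb_le_trans comb_covers.cases)

lemma covers_rtrancl_chain:
  assumes "2 \<le> m" "m \<le> n + 1" "1 \<le> j" "j \<le> j'" "j' \<le> spine_length n k m"
  shows "(Spine m j, Spine m j') \<in> (comb_covers n k)\<^sup>*"
  using assms(4,5)
proof (induction j' rule: dec_induct)
  case (step i)
  then have "(Spine m i, Spine m (Suc i)) \<in> comb_covers n k"
    using assms by (intro comb_covers.chain) auto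
  then show ?case
    using step by (auto intro: rtrancl_into_rtrancl)
qed simp

lemma covers_rtrancl_spine:
  assumes "k \<ge> 1" "2 \<le> m'" "m' \<le> m" "m \<le> n + 1"
  shows "(Spine m (spine_length n k m), Spine m' (spine_length n k m')) \<in> (comb_covers n k)\<^sup>*"
  using assms(3,4)
proof (induction m rule: dec_induct)
  case (step i)
  have "(Spine (Suc i) (spine_length n k (Suc i)), Spine i 1) \<in> comb_covers n k"
    using comb_covers.spine[of "Suc i" n k] step assms by simp
  moreover have "(Spine i 1, Spine i (spine_length n k i)) \<in> (comb_covers n k)\<^sup>*"
    using step assms by (intro covers_rtrancl_chain) (auto simp: spine_length_def)
  ultimately show ?case
    using step by (meson Suc_leD converse_rtrancl_into_rtrancl rtrancl_trans)
qed simp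

lemma covers_rtrancl_if_comb_le:
  assumes k: "k \<ge> 1" and x: "x \<in> comb n k" and y: "y \<in> comb n k" and le: "comb_le x y"
  shows "(x, y) \<in> (comb_covers n k)\<^sup>*"
proof (cases x)
  case (Leaf i)
  then show ?thesis using le by simp
next
  case x_eq: (Spine m j)
  have top: "(x, Spine m (spine_length n k m)) \<in> (comb_covers n k)\<^sup>*"
    using x x_eq by (auto intro: covers_rtrancl_chain)
  show ?thesis
  proof (cases y)
    case y_eq: (Leaf i)
    define m' where "m' = max i 2"
    have m': "2 \<le> m'" "m' \<le> m" "m \<le> n + 1"
      using x x_eq y_eq le by (auto simp: m'_def)
    have "(Spine m' (spine_length n k m'), Leaf i) \<in> comb_covers n k"
    proof (cases "i \<le> 2")
      case True
      then have "m' = 2" "i = 1 \<or> i = 2"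
        using y y_eq by (auto simp: m'_def)
      then show ?thesis
        using comb_covers.leaf1[of n k] comb_covers.leaf2[of n k] by auto
    next
      case False
      then show ?thesis
        using y y_eq by (auto simp: m'_def max_def intro: comb_covers.tooth)
    qed
    then show ?thesis
      using top covers_rtrancl_spine[OF k m'] y_eq by (auto intro: rtrancl_trans)
  next
    case y_eq: (Spine m' j')
    show ?thesis
    proof (cases "m' = m")
      case True
      then show ?thesis
        using x y x_eq y_eq le by (auto intro: covers_rtrancl_chain)
    next
      case False
      then have m': "m' < m" "2 \<le> m'" "m \<le> n + 1"
        using x y x_eq y_eq le by auto
      have "(Spine m (spine_length n k m), Spine (Suc m') (spine_length n k (Suc m')))
          \<in> (comb_covers n k)\<^sup>*"
        using m' k by (intro covers_rtrancl_spine) auto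
      moreover have "(Spine (Suc m') (spine_length n k (Suc m')), Spine m' 1) \<in> comb_covers n k"
        using comb_covers.spine[of "Suc m'" n k] m' by simp
      moreover have "(Spine m' 1, Spine m' j') \<in> (comb_covers n k)\<^sup>*"
        using y y_eq by (auto intro: covers_rtrancl_chain)
      ultimately show ?thesis
        using top y_eq by (meson rtrancl.rtrancl_into_rtrancl rtrancl_trans)
    qed
  qed
qed

lemma comb_order_iff:
  assumes "k \<ge> 1"
  shows "(x, y) \<in> comb_order n k \<longleftrightarrow> x \<in> comb n k \<and> y \<in> comb n k \<and> comb_le x y"
  using covers_rtrancl_if_comb_le[OF assms] comb_le_if_covers_rtrancl
  by (auto simp: comb_order_def)

lemma partial_order_on_comb: "partial_order_on (comb n k) (comb_order n k)"
  unfolding partial_order_on_def preorder_on_def comb_order_def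
  by (auto simp: refl_on_def trans_def antisym_def
      dest: comb_le_if_covers_rtrancl intro: comb_le_antisym)

lemma leaves_above_spine:
  assumes "k \<ge> 1" "Spine m j \<in> comb n k"
  shows "{i. (Spine m j, Leaf i) \<in> comb_order n k} = {1..m}"
  using assms by (auto simp: comb_order_iff)

lemma maximal_in_comb_iff:
  assumes "k \<ge> 1" "x \<in> comb n k"
  shows "(\<forall>y. (x, y) \<in> comb_order n k \<longrightarrow> y = x) \<longleftrightarrow> (\<exists>i. x = Leaf i)"
proof (cases x)
  case (Leaf i)
  then show ?thesis using assms by (auto simp: comb_order_iff)
next
  case (Spine m j)
  then have "(x, Leaf 1) \<in> comb_order n k"
    using assms by (auto simp: comb_order_iff)
  then show ?thesis using Spine by auto
qed

end

theory Submission
  imports Defs "HOL-Library.Multiset"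
begin

text \<open>Every rooted forest arises from the empty poset by two operations: putting a new minimum below
  everything, and taking the disjoint union. The comb only needs the disjoint union with a single
  point. Both operations have a transparent effect on the orbits of rowmotion.

  A new minimum \<open>b\<close> is invisible to the nonempty antichains, since it lies in their down-closure. The only
  change is a detour: the empty antichain is now sent to \<open>{b}\<close>, and \<open>{b}\<close> is sent to where the empty
  antichain went before. So the orbit of the empty antichain gains one member and the other orbits
  stay as they are (\<open>orbit_profile_insert_bottom\<close>).

  On a disjoint union with a point, rowmotion acts on each part separately and toggles the point.
  An orbit of even size therefore splits into two orbits of that size, while the two copies of an orbit
  of odd size \<open>s\<close> merge into one orbit of size \<open>2 * s\<close>. In either case the point is present in exactly half
  of the antichains (\<open>orbit_profile_insert_isolated\<close>).

  The comb without its root grows from two isolated leaves by repeating one step: \<open>k\<close> new minima, and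
  then one new leaf. Thus only the size of the orbit of the empty antichain can be changed by a chain, and
  the parity of \<open>k\<close> decides what the next leaf does to it. For odd \<open>k\<close> its size is odd after each chain, so it
  absorbs its own copy and grows exponentially, while the orbits of size \<open>2\<close> multiply. For even \<open>k\<close>
  every size is even and each leaf splits a twin off the orbit of the empty antichain; the twin
  keeps its size for ever and doubles in number with every later leaf, which gives one
  family of orbits for each stage.
  The root is a last minimum and adds one to the size of the orbit of the empty antichain. Tracking size, \<open>chi\<close> and
  \<open>chi_hat\<close> through these steps gives recurrences with the stated closed forms
  (\<open>orbit_profile_rootless_comb_odd\<close>, \<open>orbit_profile_rootless_comb_even\<close>). Finally, orbits of equal size have
  equal statistics because the sizes listed for different families are different.\<close>

section \<open>Orbits of a map on a finite set\<close>

lemma self_in_orbit_if_bij_betw: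
  assumes "finite S" "bij_betw f S S" "x \<in> S"
  shows "x \<in> orbit f x"
proof -
  let ?g = "perm_restrict f S"
  have "bij_betw ?g S S"
    using assms(2) by (simp add: perm_restrict_simps cong: bij_betw_cong)
  then have "?g permutes S"
    by (rule bij_imp_permutes) (simp add: perm_restrict_simps)
  then have "x \<in> orbit ?g x"
    using assms(1) permutation_self_in_orbit permutation_permutes by metis
  also have "orbit ?g x = orbit f x"
    using assms(2,3) by (intro orbit_cong0[of _ S])
      (auto simp: perm_restrict_simps bij_betw_apply)
  finally show ?thesis .
qed

lemma orbit_subset_if_closed:
  assumes "f ` S \<subseteq> S" "x \<in> S"
  shows "orbit f x \<subseteq> S"
proof
  fix y assume "y \<in> orbit f x"
  then show "y \<in> S" using assms by induction auto
qed

lemma period_of_orbit: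
  assumes "x \<in> orbit f x"
  shows "0 < card (orbit f x)" "(f ^^ card (orbit f x)) x = x"
    "inj_on (\<lambda>i. (f ^^ i) x) {..<card (orbit f x)}"
proof -
  have "card (orbit f x) = funpow_dist1 f x x"
    using orbit_conv_funpow_dist1[OF assms] card_image[OF inj_on_funpow_dist1[OF assms]]
    by (metis card_atLeastLessThan minus_nat.diff_0)
  then show "0 < card (orbit f x)" "(f ^^ card (orbit f x)) x = x"
    "inj_on (\<lambda>i. (f ^^ i) x) {..<card (orbit f x)}"
    using funpow_dist1_prop[OF assms] inj_on_funpow_dist1[OF assms]
    by (auto simp: lessThan_atLeast0)
qed

lemma orbit_of_period:
  assumes "0 < s" "(f ^^ s) x = x" "inj_on (\<lambda>i. (f ^^ i) x) {..<s}"
  shows "card (orbit f x) = s" "(\<Sum>y\<in>orbit f x. g y) = (\<Sum>i<s. g ((f ^^ i) x))"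
proof -
  have o: "orbit f x = (\<lambda>i. (f ^^ i) x) ` {..<s}"
    using orbit_altdef_bounded[OF assms(2,1)] by auto
  show "card (orbit f x) = s" using assms(3) by (simp add: o card_image)
  show "(\<Sum>y\<in>orbit f x. g y) = (\<Sum>i<s. g ((f ^^ i) x))"
    using assms(3) by (simp add: o sum.reindex)
qed

text \<open>The map \<open>g\<close> follows \<open>f\<close> but visits the new point \<open>b\<close> between
  \<open>e\<close> and \<open>f e\<close>, so only the orbit of \<open>e\<close> notices the change. This is what rowmotion does when a
  minimum \<open>b\<close> is put below a poset, with \<open>e\<close> the empty antichain.\<close>

lemma orbit_insert_after:
  assumes self: "\<And>x. x \<in> S \<Longrightarrow> x \<in> orbit f x" and closed: "f ` S \<subseteq> S"
    and "e \<in> S" "b \<notin> S" and ge: "g e = b" and gb: "g b = f e"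
    and gx: "\<And>x. x \<in> S \<Longrightarrow> x \<noteq> e \<Longrightarrow> g x = f x"
    and x: "x \<in> S"
  shows "orbit g x = (if e \<in> orbit f x then insert b (orbit f x) else orbit f x)"
    (is "_ = ?R")
proof (intro equalityI subsetI)
  have sub: "orbit f x \<subseteq> S" using orbit_subset_if_closed[OF closed x] .
  fix y assume "y \<in> orbit g x"
  then show "y \<in> ?R"
  proof induction
    case base
    show ?case
      using self[OF x] gx[OF x] ge by (cases "x = e") (auto intro: orbit.intros)
  next
    case (step y)
    show ?case
    proof (cases "y = b")
      case True
      then have "e \<in> orbit f x" using step.IH sub \<open>b \<notin> S\<close> by (auto split: if_splits)
      then show ?thesis using True gb by (auto intro: orbit.intros)
    next
      case False
      then have y: "y \<in> orbit f x" using step.IH by (auto split: if_splits)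
      then have "f y \<in> orbit f x" by (rule orbit.step)
      moreover have "y \<in> S" using y sub by blast
      ultimately show ?thesis using y ge gx[of y] by (cases "y = e") auto
    qed
  qed
next
  have sub: "orbit f x \<subseteq> S" using orbit_subset_if_closed[OF closed x] .
  have forward: "f z \<in> orbit g w" if "z \<in> S" "z = w \<or> z \<in> orbit g w" for z w
  proof (cases "z = e")
    case True
    then have "g z \<in> orbit g w" using that by (auto intro: orbit.intros)
    then have "g (g z) \<in> orbit g w" by (rule orbit.step)
    then show ?thesis using True ge gb by simp
  next
    case False
    then show ?thesis using that gx[of z] by (metis orbit.base orbit.step)
  qed
  have *: "y \<in> orbit g x" if "y \<in> orbit f x" for y
    using that
  proof induction
    case base
    show ?case using forward x by blast
  next
    case (step y)
    then show ?case using sub forward by blast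
  qed
  fix y assume "y \<in> ?R"
  then show "y \<in> orbit g x"
    using * orbit.step[of e g x] ge by (auto split: if_splits)
qed

section \<open>Rowmotion orbits and their profiles\<close>

lemma refl_of_partial_order: "partial_order_on UNIV r \<Longrightarrow> (x, x) \<in> r"
  by (simp add: partial_order_on_def preorder_on_def refl_on_def)

text \<open>The posets below are all carved out of one ambient order \<open>r\<close>, so that enlarging the carrier
  leaves the relation alone. On subsets of \<open>P\<close> the operations see \<open>r\<close> only inside \<open>P\<close>.\<close>

lemma rowmotion_Restr:
  assumes "A \<subseteq> P"
  shows "down_closure P (Restr r P) A = down_closure P r A"
    and "rowmotion P (Restr r P) A = rowmotion P r A"
proof -
  show *: "down_closure P (Restr r P) A = down_closure P r A"
    using assms by (auto simp: down_closure_def)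
  show "rowmotion P (Restr r P) A = rowmotion P r A"
    unfolding rowmotion_def * by (auto simp: minimal_elements_def)
qed

lemma antichains_Restr: "antichains P (Restr r P) = antichains P r"
  by (auto simp: antichains_def)

lemma bij_betw_rowmotion_ambient:
  assumes "finite P" "partial_order_on UNIV r"
  shows "bij_betw (rowmotion P r) (antichains P r) (antichains P r)"
proof -
  have "partial_order_on P (Restr r P)"
    using assms(2) by (auto simp: partial_order_on_def preorder_on_def refl_on_def trans_def antisym_def)
  from bij_betw_rowmotion[OF assms(1) this]
  have "bij_betw (rowmotion P (Restr r P)) (antichains P r) (antichains P r)"
    by (simp add: antichains_Restr)
  then show ?thesis
    by (rule bij_betw_cong[THEN iffD1, rotated]) (auto simp: antichains_def rowmotion_Restr)
qed

lemma empty_in_antichains [simp]: "{} \<in> antichains P r"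
  by (simp add: antichains_def)

lemma rowmotion_image_antichains: "rowmotion P r ` antichains P r \<subseteq> antichains P r"
  using rowmotion_in_antichains by blast

lemma self_in_rowmotion_orbit:
  assumes "finite P" "partial_order_on UNIV r" "A \<in> antichains P r"
  shows "A \<in> orbit (rowmotion P r) A"
  using assms bij_betw_rowmotion_ambient finite_antichains self_in_orbit_if_bij_betw by metis

definition orbit_stats :: "'a set \<Rightarrow> 'a rel \<Rightarrow> 'a set \<Rightarrow> nat \<times> real \<times> real" where
  "orbit_stats P r A = (let X = orbit (rowmotion P r) A in
    (card X, real (chi X), real (chi_hat P r X)))"

text \<open>The orbit of the empty antichain is the one that grows when a minimum is adjoined; the
  antichains outside of it are collected separately.\<close>

definition off_empty_orbit :: "'a set \<Rightarrow> 'a rel \<Rightarrow> 'a set set" where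
  "off_empty_orbit P r = {A \<in> antichains P r. {} \<notin> orbit (rowmotion P r) A}"

text \<open>The multiset records the statistics of an orbit once for every antichain in it, hence an orbit
  of size \<open>s\<close> contributes \<open>s\<close> equal entries. Counting antichains instead of orbits makes the effect of
  an isolated point uniform: every antichain yields two, whether its orbit splits or not.\<close>

definition orbit_profile ::
  "'a set \<Rightarrow> 'a rel \<Rightarrow> (nat \<times> real \<times> real) \<times> (nat \<times> real \<times> real) multiset" where
  "orbit_profile P r =
    (orbit_stats P r {}, image_mset (orbit_stats P r) (mset_set (off_empty_orbit P r)))"

section \<open>Adjoining a minimum\<close>

context
  fixes P :: "'a set" and r b
  assumes po: "partial_order_on UNIV r" and b: "b \<notin> P" and below: "\<And>x. x \<in> P \<Longrightarrow> (b, x) \<in> r"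
begin

lemma antichains_insert_bottom: "antichains (insert b P) r = insert {b} (antichains P r)"
proof -
  have "(b, b) \<in> r" by (rule refl_of_partial_order[OF po])
  then show ?thesis using b below unfolding antichains_def by auto
qed

lemma above_bottom: "x \<in> P \<Longrightarrow> (x, b) \<notin> r"
  using po b below unfolding partial_order_on_def by (metis antisymD)

lemma down_closure_insert_bottom:
  assumes "A \<subseteq> P"
  shows "down_closure (insert b P) r A = (if A = {} then {} else insert b (down_closure P r A))"
  using assms below unfolding down_closure_def by auto

lemma down_closure_bottom: "down_closure (insert b P) r {b} = {b}"
  using above_bottom refl_of_partial_order[OF po] by (auto simp: down_closure_def)

text \<open>A nonempty antichain of \<open>P\<close> has \<open>b\<close> in its down-closure, which hides \<open>b\<close> from rowmotion; the
  empty antichain leaves everything, and then \<open>b\<close> is the only minimal element.\<close>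

lemma rowmotion_insert_bottom:
  "rowmotion (insert b P) r {} = {b}"
  "rowmotion (insert b P) r {b} = rowmotion P r {}"
  "A \<in> antichains P r \<Longrightarrow> A \<noteq> {} \<Longrightarrow> rowmotion (insert b P) r A = rowmotion P r A"
proof -
  show "rowmotion (insert b P) r {} = {b}"
    using above_bottom below b by (auto simp: rowmotion_def down_closure_def minimal_elements_def)
  have "{x \<in> insert b P. x \<notin> {b}} = {x \<in> P. x \<notin> down_closure P r {}}"
    using b by (auto simp: down_closure_def)
  then show "rowmotion (insert b P) r {b} = rowmotion P r {}"
    by (simp only: rowmotion_def down_closure_bottom)
  assume "A \<in> antichains P r" "A \<noteq> {}"
  moreover then have "{x \<in> insert b P. x \<notin> insert b (down_closure P r A)}
      = {x \<in> P. x \<notin> down_closure P r A}"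
    using b by auto
  moreover have "A \<subseteq> P" using \<open>A \<in> antichains P r\<close> by (auto simp: antichains_def)
  ultimately show "rowmotion (insert b P) r A = rowmotion P r A"
    by (simp only: rowmotion_def down_closure_insert_bottom if_False)
qed

lemma orbit_insert_bottom:
  assumes "finite P" "A \<in> antichains P r"
  shows "orbit (rowmotion (insert b P) r) A =
    (let X = orbit (rowmotion P r) A in if {} \<in> X then insert {b} X else X)"
proof -
  have "{b} \<notin> antichains P r" using b by (auto simp: antichains_def)
  then show ?thesis
    unfolding Let_def
    by (intro orbit_insert_after[of "antichains P r"] self_in_rowmotion_orbit assms po
        rowmotion_image_antichains rowmotion_insert_bottom) auto
qed

text \<open>Every antichain of the orbit gains \<open>b\<close> in its down-closure, except the empty one.\<close>

lemma chi_hat_insert_bottom: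
  assumes "finite P" "A \<in> antichains P r" 
  defines "X \<equiv> orbit (rowmotion P r) A"
  shows "chi_hat (insert b P) r X + (if {} \<in> X then 1 else 0) = chi_hat P r X + card X"
proof -
  have sub: "X \<subseteq> antichains P r"
    unfolding X_def by (rule orbit_subset_if_closed[OF rowmotion_image_antichains assms(2)])
  then have fin: "finite X" using assms(1) finite_antichains finite_subset by metis
  have "card (down_closure (insert b P) r B) + (if B = {} then 1 else 0) = card (down_closure P r B) + 1"
    if "B \<in> X" for B
  proof -
    have "B \<subseteq> P" using sub that by (auto simp: antichains_def)
    moreover have "finite (down_closure P r B)" "b \<notin> down_closure P r B"
      using b assms(1) by (auto simp: down_closure_def)
    ultimately show ?thesis
      by (auto simp: down_closure_insert_bottom) (simp add: down_closure_def)
  qed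
  then have "(\<Sum>B\<in>X. card (down_closure (insert b P) r B) + (if B = {} then 1 else 0))
      = (\<Sum>B\<in>X. card (down_closure P r B) + 1)"
    by (rule sum.cong[OF refl])
  then show ?thesis
    using fin by (simp add: chi_hat_def sum.distrib sum.delta' sum_Suc)
qed

lemma orbit_stats_insert_bottom:
  assumes fin: "finite P" and A: "A \<in> antichains P r" and st: "orbit_stats P r A = (s, c, h)"
  shows "orbit_stats (insert b P) r A =
    (if {} \<in> orbit (rowmotion P r) A then (s + 1, c + 1, h + s) else (s, c, h + s))"
proof -
  let ?X = "orbit (rowmotion P r) A"
  have sub: "?X \<subseteq> antichains P r"
    by (rule orbit_subset_if_closed[OF rowmotion_image_antichains A])
  then have finX: "finite ?X" using fin finite_antichains finite_subset by metis
  have "{b} \<notin> antichains P r" using b by (auto simp: antichains_def)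
  then have bX: "{b} \<notin> ?X" using sub by blast
  have *: "chi_hat (insert b P) r ?X + (if {} \<in> ?X then 1 else 0) = chi_hat P r ?X + card ?X"
    using chi_hat_insert_bottom[OF fin A] by simp
  have s: "s = card ?X" "c = real (chi ?X)" "h = real (chi_hat P r ?X)"
    using st by (auto simp: orbit_stats_def Let_def)
  show ?thesis
  proof (cases "{} \<in> ?X")
    case True
    then have "chi_hat (insert b P) r (insert {b} ?X) = chi_hat P r ?X + card ?X"
      using * finX bX down_closure_bottom by (simp add: chi_hat_def)
    moreover have "chi (insert {b} ?X) = chi ?X + 1"
      using finX bX by (simp add: chi_def)
    ultimately show ?thesis
      using True finX bX
      by (simp add: orbit_stats_def orbit_insert_bottom[OF fin A] s)
  next
    case False
    then show ?thesis using * by (simp add: orbit_stats_def Let_def orbit_insert_bottom[OF fin A] s)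
  qed
qed

lemma off_empty_orbit_insert_bottom:
  assumes fin: "finite P"
  shows "off_empty_orbit (insert b P) r = off_empty_orbit P r"
proof -
  have "{b} \<notin> antichains P r" using b by (auto simp: antichains_def)
  have "{} \<in> orbit (rowmotion (insert b P) r) {b}"
    using self_in_rowmotion_orbit[of "insert b P" r "{}"] fin po
      rowmotion_insert_bottom(1) self_in_orbit_step
    by (metis empty_in_antichains finite_insert)
  then show ?thesis
    using orbit_insert_bottom[OF fin]
    by (auto simp: off_empty_orbit_def antichains_insert_bottom Let_def split: if_splits)
qed

text \<open>In the orbit of the empty antichain, \<open>s - 1\<close> down-closures gain the element \<open>b\<close>, and the new member
  \<open>{b}\<close> has a down-closure of size \<open>1\<close>. The other orbits keep their members, and each of their \<open>s\<close>
  down-closures gains \<open>b\<close>. So the last entry grows by \<open>s\<close> in both cases.\<close>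

lemma orbit_profile_insert_bottom:
  assumes fin: "finite P" and pr: "orbit_profile P r = ((s, c, h), N)"
  shows "orbit_profile (insert b P) r =
    ((s + 1, c + 1, h + s), image_mset (\<lambda>(s, c, h). (s, c, h + s)) N)"
proof -
  have e: "{} \<in> orbit (rowmotion P r) {}"
    using self_in_rowmotion_orbit[OF fin po] by simp
  have "orbit_stats P r {} = (s, c, h)" and N: "N = image_mset (orbit_stats P r) (mset_set (off_empty_orbit P r))"
    using pr by (auto simp: orbit_profile_def)
  then have 1: "orbit_stats (insert b P) r {} = (s + 1, c + 1, h + s)"
    using orbit_stats_insert_bottom[OF fin] e by simp
  have "orbit_stats (insert b P) r A = (\<lambda>(s, c, h). (s, c, h + s)) (orbit_stats P r A)"
    if "A \<in> off_empty_orbit P r" for A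
    using that orbit_stats_insert_bottom[OF fin, of A]
    by (cases "orbit_stats P r A") (auto simp: off_empty_orbit_def)
  moreover have "finite (off_empty_orbit P r)"
    using finite_antichains[OF fin] by (simp add: off_empty_orbit_def)
  ultimately have "image_mset (orbit_stats (insert b P) r) (mset_set (off_empty_orbit P r)) =
     image_mset (\<lambda>(s, c, h). (s, c, h + s)) N"
    unfolding N by (auto simp: multiset.map_comp intro!: image_mset_cong)
  then show ?thesis
    using 1 by (simp add: orbit_profile_def off_empty_orbit_insert_bottom[OF fin])
qed

end

section \<open>Adjoining an isolated point\<close>

lemma sum_lessThan_add:
  fixes g :: "nat \<Rightarrow> 'b :: comm_monoid_add"
  shows "(\<Sum>i<a + b. g i) = (\<Sum>i<a. g i) + (\<Sum>i<b. g (a + i))"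
  by (induction b) (simp_all add: add.assoc)

lemma sum_alternating: "(\<Sum>i<2 * m. of_bool (c \<noteq> odd i)) = (m :: nat)"
  by (induction m) auto

text \<open>Here \<open>h c y\<close> stands for the pair of a state \<open>y\<close> and a bit \<open>c\<close>, and \<open>g\<close> advances the state by \<open>f\<close> while
  flipping the bit. After \<open>s\<close> steps the state returns, and the bit returns with it exactly when \<open>s\<close> is
  even. So the period is \<open>s\<close> or \<open>2 * s\<close>, and as it is even in both cases, the bit is set half of the
  time. The factor \<open>2\<close> in the last equation avoids a division.\<close>

lemma orbit_alternating:
  fixes f :: "'b \<Rightarrow> 'b" and g :: "'c \<Rightarrow> 'c" and h :: "bool \<Rightarrow> 'b \<Rightarrow> 'c"
  assumes closed: "f ` S \<subseteq> S" and x: "x \<in> S" "x \<in> orbit f x"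
    and inj: "\<And>c d y z. y \<in> S \<Longrightarrow> z \<in> S \<Longrightarrow> h c y = h d z \<Longrightarrow> c = d \<and> y = z"
    and gh: "\<And>c y. y \<in> S \<Longrightarrow> g (h c y) = h (\<not> c) (f y)"
  defines "s \<equiv> card (orbit f x)"
  defines "m \<equiv> (if even s then 1 else 2)"
  shows "orbit g (h c x) \<subseteq> (\<Union>d. h d ` orbit f x)"
    and "card (orbit g (h c x)) = m * s"
    and "\<And>F F\<^sub>0 :: _ \<Rightarrow> nat. (\<And>d y. y \<in> S \<Longrightarrow> F (h d y) = F\<^sub>0 y + of_bool d) \<Longrightarrow>
      2 * sum F (orbit g (h c x)) = m * (2 * sum F\<^sub>0 (orbit f x) + s)"
proof -
  have subS: "orbit f x \<subseteq> S" by (rule orbit_subset_if_closed[OF closed x(1)])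
  show "orbit g (h c x) \<subseteq> (\<Union>d. h d ` orbit f x)"
  proof
    fix y assume "y \<in> orbit g (h c x)"
    then show "y \<in> (\<Union>d. h d ` orbit f x)"
    proof induction
      case base
      show ?case using gh[OF x(1)] orbit.base[of f x] by auto
    next
      case (step y)
      then obtain d z where "y = h d z" "z \<in> orbit f x" by auto
      then show ?case using gh[of z d] subS orbit.step[of z f x] by auto
    qed
  qed
  have inS: "(f ^^ i) x \<in> S" for i
    by (induction i) (use x(1) closed in auto)
  have pow: "(g ^^ i) (h c x) = h (c \<noteq> odd i) ((f ^^ i) x)" for i
    by (induction i) (auto simp: gh inS)
  note per = period_of_orbit[OF x(2), folded s_def]
  \<comment> \<open>The period of \<open>g\<close> is \<open>m * s\<close>: two coinciding iterates agree in the state, so their indices are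
    congruent modulo \<open>s\<close>, and in the bit, so the indices have the same parity.\<close>
  have even_N: "even (m * s)" by (simp add: m_def)
  have N: "(f ^^ (m * s)) x = x"
    by (metis funpow_mod_eq[OF per(2)] mod_mult_self2_is_0 funpow_0)
  have pos: "0 < m * s" using per(1) by (simp add: m_def)
  have injN: "inj_on (\<lambda>i. (g ^^ i) (h c x)) {..<m * s}"
  proof (rule inj_onI)
    fix i j assume ij: "i \<in> {..<m * s}" "j \<in> {..<m * s}" and eq: "(g ^^ i) (h c x) = (g ^^ j) (h c x)"
    from eq have par: "even i \<longleftrightarrow> even j" and fij: "(f ^^ i) x = (f ^^ j) x"
      using inj[OF inS[of i] inS[of j]] by (auto simp: pow)
    have "i mod s = j mod s"
      using per(1) fij funpow_mod_eq[OF per(2), of i, symmetric] funpow_mod_eq[OF per(2), of j, symmetric]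
      by (intro inj_onD[OF per(3)]) auto
    then have cong: "s dvd nat \<bar>int i - int j\<bar>"
      by (metis mod_eq_dvd_iff of_nat_mod int_dvd_int_iff dvd_abs_iff nat_0_le abs_ge_zero)
    have "m * s dvd nat \<bar>int i - int j\<bar>"
    proof (cases "even s")
      case True then show ?thesis using cong by (simp add: m_def)
    next
      case False
      have "2 dvd nat \<bar>int i - int j\<bar>" using par by (auto simp: even_nat_iff)
      then have "2 * s dvd nat \<bar>int i - int j\<bar>"
        using cong False by (intro divides_mult) auto
      then show ?thesis using False by (simp add: m_def)
    qed
    moreover have "nat \<bar>int i - int j\<bar> < m * s" using ij by auto
    ultimately have "nat \<bar>int i - int j\<bar> = 0" by (metis nat_dvd_not_less neq0_conv)
    then show "i = j" by simp
  qed
  have gN: "(g ^^ (m * s)) (h c x) = h c x"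
    using even_N N by (simp add: pow)
  note perg = orbit_of_period[OF pos gN injN]
  show "card (orbit g (h c x)) = m * s" by (rule perg)
  fix F F\<^sub>0 :: "_ \<Rightarrow> nat" assume F: "\<And>d y. y \<in> S \<Longrightarrow> F (h d y) = F\<^sub>0 y + of_bool d"
  have "sum F (orbit g (h c x)) = (\<Sum>i<m * s. F\<^sub>0 ((f ^^ i) x)) + (\<Sum>i<m * s. of_bool (c \<noteq> odd i))"
    by (simp only: perg(2) pow F[OF inS] sum.distrib)
  moreover have "(\<Sum>i<m * s. F\<^sub>0 ((f ^^ i) x)) = m * (\<Sum>i<s. F\<^sub>0 ((f ^^ i) x))"
  proof -
    have "(f ^^ (s + i)) x = (f ^^ i) x" for i
      using per(2) by (simp add: funpow_add add.commute[of s])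
    then have "(\<Sum>i<s + s. F\<^sub>0 ((f ^^ i) x)) = 2 * (\<Sum>i<s. F\<^sub>0 ((f ^^ i) x))"
      by (simp add: sum_lessThan_add)
    then show ?thesis by (simp add: m_def mult_2)
  qed
  moreover have "2 * (\<Sum>i<m * s. of_bool (c \<noteq> odd i)) = m * s"
    using even_N sum_alternating[of c "m * s div 2"] by simp
  moreover have "(\<Sum>i<s. F\<^sub>0 ((f ^^ i) x)) = sum F\<^sub>0 (orbit f x)"
    by (rule orbit_of_period(2)[OF per, symmetric])
  ultimately show "2 * sum F (orbit g (h c x)) = m * (2 * sum F\<^sub>0 (orbit f x) + s)"
    by (simp add: algebra_simps)
qed

text \<open>The statistics of an orbit after an isolated point has been added to the poset: the new orbit
  covers the old one \<open>m\<close> times, and the point belongs to half of its members.\<close>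

definition double_stats :: "nat \<times> real \<times> real \<Rightarrow> nat \<times> real \<times> real" where
  "double_stats = (\<lambda>(s, c, h). let m = (if even s then 1 else 2) in
    (m * s, m * (c + s / 2), m * (h + s / 2)))"

context
  fixes P :: "'a set" and r p
  assumes po: "partial_order_on UNIV r" and p: "p \<notin> P"
    and iso: "\<And>x. x \<in> P \<Longrightarrow> (p, x) \<notin> r \<and> (x, p) \<notin> r"
begin

text \<open>The antichains of the enlarged poset are pairs of an old antichain and a bit that tells whether
  \<open>p\<close> is present. Rowmotion acts on the two components independently, and flips the bit.\<close>

definition with_point :: "bool \<Rightarrow> 'a set \<Rightarrow> 'a set" where
  "with_point c A = (if c then insert p A else A)"

lemma antichains_insert_isolated:
  "antichains (insert p P) r = antichains P r \<union> insert p ` antichains P r"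
proof -
  have "A \<in> insert p ` antichains P r" if "A \<in> antichains (insert p P) r" "p \<in> A" for A
  proof -
    have "A = insert p (A - {p})" "A - {p} \<in> antichains P r"
      using that by (auto simp: antichains_def)
    then show ?thesis by blast
  qed
  moreover have "A \<in> antichains P r" if "A \<in> antichains (insert p P) r" "p \<notin> A" for A
    using that by (auto simp: antichains_def)
  moreover have "insert p A \<in> antichains (insert p P) r" "A \<in> antichains (insert p P) r"
    if "A \<in> antichains P r" for A
    using that iso by (auto simp: antichains_def)
  ultimately show ?thesis by blast
qed

lemma down_closure_with_point:
  assumes "A \<subseteq> P"
  shows "down_closure (insert p P) r (with_point c A) = with_point c (down_closure P r A)"
  using assms iso refl_of_partial_order[OF po, of p] unfolding down_closure_def with_point_def by auto

lemma rowmotion_with_point: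
  assumes "A \<in> antichains P r"
  shows "rowmotion (insert p P) r (with_point c A) = with_point (\<not> c) (rowmotion P r A)"
proof -
  have A: "A \<subseteq> P" using assms by (auto simp: antichains_def)
  have "{x \<in> insert p P. x \<notin> with_point c (down_closure P r A)}
      = with_point (\<not> c) {x \<in> P. x \<notin> down_closure P r A}"
    using p by (auto simp: with_point_def down_closure_def)
  moreover have "minimal_elements r (with_point d Q) = with_point d (minimal_elements r Q)"
    if "Q \<subseteq> P" for d Q
    using that iso by (auto simp: minimal_elements_def with_point_def)
  ultimately show ?thesis
    by (simp add: rowmotion_def down_closure_with_point[OF A])
qed

lemma with_point_inj:
  "A \<in> antichains P r \<Longrightarrow> B \<in> antichains P r \<Longrightarrow> with_point c A = with_point d B \<Longrightarrow> c = d \<and> A = B"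
  using p unfolding with_point_def antichains_def
  by (auto split: if_splits)

lemma orbit_with_point:
  assumes "finite P" "A \<in> antichains P r"
  defines "X \<equiv> orbit (rowmotion P r) A"
  defines "m \<equiv> (if even (card X) then 1 else 2)"
  shows "orbit (rowmotion (insert p P) r) (with_point c A) \<subseteq> (\<Union>d. with_point d ` X)"
    and "card (orbit (rowmotion (insert p P) r) (with_point c A)) = m * card X"
    and "\<And>F F\<^sub>0 :: _ \<Rightarrow> nat.
      (\<And>d B. B \<in> antichains P r \<Longrightarrow> F (with_point d B) = F\<^sub>0 B + of_bool d) \<Longrightarrow>
      2 * sum F (orbit (rowmotion (insert p P) r) (with_point c A)) = m * (2 * sum F\<^sub>0 X + card X)"
  unfolding X_def m_def
  by (intro orbit_alternating[where S = "antichains P r"] rowmotion_image_antichains assms(2)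
      self_in_rowmotion_orbit assms(1) po with_point_inj rowmotion_with_point; assumption)+

lemma orbit_stats_with_point:
  assumes "finite P" "A \<in> antichains P r"
  shows "orbit_stats (insert p P) r (with_point c A) = double_stats (orbit_stats P r A)"
proof -
  note o = orbit_with_point[OF assms, where c = c]
  let ?X = "orbit (rowmotion P r) A" and ?Y = "orbit (rowmotion (insert p P) r) (with_point c A)"
  let ?m = "if even (card ?X) then 1 else 2"
  have "card (with_point d B) = card B + of_bool d" if "B \<in> antichains P r" for d B
  proof -
    have "finite B" "p \<notin> B"
      using that p assms(1) finite_subset[of B P] by (auto simp: antichains_def)
    then show ?thesis by (simp add: with_point_def)
  qed
  then have 2: "2 * chi ?Y = ?m * (2 * chi ?X + card ?X)"
    unfolding chi_def by (rule o(3)[of card card])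
  have "card (down_closure (insert p P) r (with_point d B)) = card (down_closure P r B) + of_bool d"
    if "B \<in> antichains P r" for d B
  proof -
    have "B \<subseteq> P" using that by (auto simp: antichains_def)
    moreover have "finite (down_closure P r B)" "p \<notin> down_closure P r B"
      using assms(1) p by (auto simp: down_closure_def)
    ultimately show ?thesis by (simp add: down_closure_with_point) (simp add: with_point_def)
  qed
  then have 3: "2 * chi_hat (insert p P) r ?Y = ?m * (2 * chi_hat P r ?X + card ?X)"
    unfolding chi_hat_def
    by (rule o(3)[of "\<lambda>B. card (down_closure (insert p P) r B)" "\<lambda>B. card (down_closure P r B)"])
  have half: "real a = real m * (real b + real s / 2)" if "2 * a = m * (2 * b + s)" for a b m s :: nat
  proof -
    have "2 * real a = real m * (2 * real b + real s)"
      using that by (metis of_nat_add of_nat_mult of_nat_numeral)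
    then show ?thesis by (simp add: field_simps)
  qed
  show ?thesis
    using o(2) half[OF 2] half[OF 3] by (simp add: orbit_stats_def double_stats_def Let_def)
qed

text \<open>Over the old orbit \<open>X\<close> of the empty antichain lie \<open>2 * card X\<close> antichains, and the new orbit of the
  empty antichain need not exhaust them.\<close>

lemma off_empty_orbit_insert_isolated:
  assumes fin: "finite P"
  defines "X \<equiv> orbit (rowmotion P r) {}"
  shows "off_empty_orbit (insert p P) r =
    off_empty_orbit P r \<union> insert p ` off_empty_orbit P r \<union>
    (X \<union> insert p ` X - orbit (rowmotion (insert p P) r) {})"
proof -
  let ?f = "rowmotion P r" and ?g = "rowmotion (insert p P) r"
  let ?O = "orbit ?g {}"
  have self: "A \<in> orbit ?f A" if "A \<in> antichains P r" for A
    by (rule self_in_rowmotion_orbit[OF fin po that])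
  have self': "A \<in> orbit ?g A" if "A \<in> antichains (insert p P) r" for A
    by (rule self_in_rowmotion_orbit[OF _ po that]) (simp add: fin)
  have X: "X \<subseteq> antichains P r"
    unfolding X_def by (rule orbit_subset_if_closed[OF rowmotion_image_antichains]) simp
  have swap: "{} \<in> orbit ?f A \<longleftrightarrow> A \<in> X" if "A \<in> antichains P r" for A
    unfolding X_def using that self by (meson empty_in_antichains orbit_swap)
  have swap': "{} \<in> orbit ?g A \<longleftrightarrow> A \<in> ?O" if "A \<in> antichains (insert p P) r" for A
    using that self' by (meson empty_in_antichains orbit_swap)
  have "orbit ?g (with_point False {}) \<subseteq> (\<Union>d. with_point d ` X)"
    unfolding X_def by (rule orbit_with_point(1)[OF fin]) simp
  then have O: "?O \<subseteq> X \<union> insert p ` X" by (auto simp: with_point_def split: if_splits)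
  have off: "off_empty_orbit P r = antichains P r - X"
    using swap by (auto simp: off_empty_orbit_def)
  have off': "off_empty_orbit (insert p P) r = antichains (insert p P) r - ?O"
    using swap' by (auto simp: off_empty_orbit_def)
  have ins: "insert p A = insert p B \<longleftrightarrow> A = B" if "A \<in> antichains P r" "B \<in> antichains P r" for A B
    using with_point_inj[OF that, of True True] by (auto simp: with_point_def)
  have ne: "insert p B \<notin> antichains P r" for B
    using p by (auto simp: antichains_def)
  have img: "insert p ` (antichains P r - X) = insert p ` antichains P r - insert p ` X"
    using X ins by (intro inj_on_image_set_diff[of _ "antichains P r"]) (auto simp: inj_on_def)
  show ?thesis
    unfolding off off' antichains_insert_isolated img using O X ne by blast
qed

text \<open>If \<open>s\<close> is even, the two copies of the orbit of the empty antichain form two orbits, and only one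
  of them contains the empty antichain; the other joins the multiset with its \<open>s\<close> antichains. If \<open>s\<close> is
  odd, the two copies merge.\<close>

lemma orbit_profile_insert_isolated:
  assumes fin: "finite P" and pr: "orbit_profile P r = ((s, c, h), N)"
  shows "orbit_profile (insert p P) r =
    (double_stats (s, c, h),
     repeat_mset 2 (image_mset double_stats N) +
     (if even s then replicate_mset s (double_stats (s, c, h)) else {#}))"
proof -
  let ?f = "rowmotion P r" and ?g = "rowmotion (insert p P) r"
  let ?X = "orbit ?f {}" and ?O = "orbit ?g {}"
  let ?st = "orbit_stats (insert p P) r"
  define U where "U = off_empty_orbit P r"
  define V where "V = insert p ` U"
  define W where "W = ?X \<union> insert p ` ?X - ?O"
  have self: "{} \<in> ?X"
    by (rule self_in_rowmotion_orbit[OF fin po]) simp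
  have st0: "orbit_stats P r {} = (s, c, h)" and
    N: "N = image_mset (orbit_stats P r) (mset_set U)"
    using pr by (auto simp: orbit_profile_def U_def)
  have s: "s = card ?X" using st0 by (simp add: orbit_stats_def Let_def)
  have UA: "U \<subseteq> antichains P r" by (auto simp: U_def off_empty_orbit_def)
  have XA: "?X \<subseteq> antichains P r"
    by (rule orbit_subset_if_closed[OF rowmotion_image_antichains]) simp
  have fins: "finite U" "finite V" "finite W" "finite ?X"
    using finite_antichains[OF fin] UA XA by (auto simp: V_def W_def intro: finite_subset)
  have ne: "insert p B \<notin> antichains P r" for B
    using p by (auto simp: antichains_def)
  have ins: "insert p A = insert p B \<longleftrightarrow> A = B" if "A \<in> antichains P r" "B \<in> antichains P r" for A B
    using with_point_inj[OF that, of True True] by (auto simp: with_point_def)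
  have inj: "inj_on (insert p) (antichains P r)" using ins by (auto simp: inj_on_def)
  have UX: "U \<inter> ?X = {}"
  proof -
    have "{} \<in> orbit ?f A" if "A \<in> ?X" for A
      using that self orbit_swap by metis
    then show ?thesis by (auto simp: U_def off_empty_orbit_def)
  qed
  have disj: "U \<inter> V = {}" "(U \<union> V) \<inter> W = {}"
    using UX UA XA ne ins by (auto simp: V_def W_def) blast+
  have "off_empty_orbit (insert p P) r = U \<union> V \<union> W"
    using off_empty_orbit_insert_isolated[OF fin] by (simp add: U_def V_def W_def)
  then have ms: "mset_set (off_empty_orbit (insert p P) r) = mset_set U + mset_set V + mset_set W"
    using disj fins by (simp add: mset_set_Union)
  have stat: "?st A = double_stats (orbit_stats P r A)" "?st (insert p A) = double_stats (orbit_stats P r A)"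
    if "A \<in> antichains P r" for A
    using orbit_stats_with_point[OF fin that, of False] orbit_stats_with_point[OF fin that, of True]
    by (auto simp: with_point_def)
  have U: "image_mset ?st (mset_set U) = image_mset double_stats N"
    using fins UA stat(1) unfolding N by (auto simp: multiset.map_comp intro!: image_mset_cong)
  have "mset_set V = image_mset (insert p) (mset_set U)"
    unfolding V_def using inj_on_subset[OF inj UA] by (simp add: image_mset_mset_set)
  then have V: "image_mset ?st (mset_set V) = image_mset double_stats N"
    using fins UA stat(2) unfolding N by (auto simp: multiset.map_comp intro!: image_mset_cong)
  have cardO: "card ?O = (if even s then 1 else 2) * s" and
    OX: "?O \<subseteq> ?X \<union> insert p ` ?X"
    using orbit_with_point(2)[OF fin, where A = "{}" and c = False] orbit_with_point(1)[OF fin, where A = "{}" and c = False] self s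
    by (auto simp: with_point_def split: if_splits)
  have "card (?X \<union> insert p ` ?X) = 2 * s"
    using fins XA ne inj_on_subset[OF inj XA] s by (subst card_Un_disjoint) (auto simp: card_image)
  then have cardW: "card W = (if even s then s else 0)"
    using OX cardO fins by (auto simp: W_def card_Diff_subset finite_subset)
  have "?st A = double_stats (s, c, h)" if "A \<in> W" for A
  proof -
    obtain B where B: "B \<in> ?X" "A = B \<or> A = insert p B" using \<open>A \<in> W\<close> by (auto simp: W_def)
    have "orbit ?f B = ?X"
      using B(1) self by (meson cyclic_on_singleI orbit_cyclic_eq3)
    then have "orbit_stats P r B = (s, c, h)" using st0 by (simp add: orbit_stats_def)
    then show ?thesis using B XA stat by auto
  qed
  then have "image_mset ?st (mset_set W) = image_mset (\<lambda>_. double_stats (s, c, h)) (mset_set W)"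
    using fins by (intro image_mset_cong) auto
  then have W: "image_mset ?st (mset_set W) = replicate_mset (card W) (double_stats (s, c, h))"
    by (simp add: image_mset_const_eq)
  have "?st {} = double_stats (s, c, h)" using stat(1)[of "{}"] st0 by simp
  then show ?thesis
    unfolding orbit_profile_def ms by (simp add: U V W cardW numeral_2_eq_2)
qed

end

section \<open>From profiles to orbits\<close>

text \<open>Apart from the orbit of the empty antichain, the orbits of size \<open>s\<close> partition the antichains that the
  multiset of the profile records with size \<open>s\<close>, so the multiset determines how many such orbits there are.\<close>

lemma orbits_of_orbit_profile:
  assumes fin: "finite P" and po: "partial_order_on UNIV r"
    and pr: "orbit_profile P r = (u, N)"
  obtains X\<^sub>0 where "X\<^sub>0 \<in> rowmotion_orbits P r"
    and "(card X\<^sub>0, real (chi X\<^sub>0), real (chi_hat P r X\<^sub>0)) = u"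
    and "\<And>X. X \<in> rowmotion_orbits P r - {X\<^sub>0} \<Longrightarrow> (card X, real (chi X), real (chi_hat P r X)) \<in># N"
    and "\<And>s. s * card {X \<in> rowmotion_orbits P r - {X\<^sub>0}. card X = s}
      = size (filter_mset (\<lambda>t. fst t = s) N)"
proof
  let ?f = "rowmotion P r"
  define X\<^sub>0 where "X\<^sub>0 = orbit ?f {}"
  define U where "U = off_empty_orbit P r"
  have u: "orbit_stats P r {} = u" and N: "N = image_mset (orbit_stats P r) (mset_set U)"
    using pr by (auto simp: orbit_profile_def U_def)
  have finA: "finite (antichains P r)" by (rule finite_antichains[OF fin])
  then have finU: "finite U" by (simp add: U_def off_empty_orbit_def)
  have self: "A \<in> orbit ?f A" if "A \<in> antichains P r" for A
    by (rule self_in_rowmotion_orbit[OF fin po that])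
  have sub: "orbit ?f A \<subseteq> antichains P r" if "A \<in> antichains P r" for A
    by (rule orbit_subset_if_closed[OF rowmotion_image_antichains that])
  have eq: "orbit ?f B = orbit ?f A" if "A \<in> antichains P r" "B \<in> orbit ?f A" for A B
    using self[OF that(1)] that(2) by (meson cyclic_on_singleI orbit_cyclic_eq3)
  have U: "A \<in> U \<longleftrightarrow> A \<in> antichains P r \<and> orbit ?f A \<noteq> X\<^sub>0" for A
    using self eq[of A "{}"] unfolding U_def off_empty_orbit_def X\<^sub>0_def by auto
  show "orbit ?f {} \<in> rowmotion_orbits P r"
    by (simp add: rowmotion_orbits_def)
  show "(card (orbit ?f {}), real (chi (orbit ?f {})), real (chi_hat P r (orbit ?f {}))) = u"
    using u by (simp add: orbit_stats_def Let_def)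
  have orbits: "rowmotion_orbits P r - {X\<^sub>0} = orbit ?f ` U"
    by (auto simp: rowmotion_orbits_def U)
  show "(card X, real (chi X), real (chi_hat P r X)) \<in># N"
    if "X \<in> rowmotion_orbits P r - {orbit ?f {}}" for X
  proof -
    obtain A where "A \<in> U" "X = orbit ?f A" using \<open>X \<in> _\<close> orbits by (auto simp: X\<^sub>0_def)
    then have "orbit_stats P r A \<in># N" using finU by (simp add: N)
    then show ?thesis using \<open>X = _\<close> by (simp add: orbit_stats_def Let_def)
  qed
  fix s
  let ?C = "{X \<in> rowmotion_orbits P r - {X\<^sub>0}. card X = s}"
  have un: "\<Union>?C = {A \<in> U. card (orbit ?f A) = s}"
  proof (intro equalityI subsetI)
    fix A assume "A \<in> \<Union>?C"
    then obtain B where B: "B \<in> U" "A \<in> orbit ?f B" "card (orbit ?f B) = s"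
      unfolding orbits by auto
    then show "A \<in> {A \<in> U. card (orbit ?f A) = s}"
      using eq[of B A] sub[of B] by (auto simp: U)
  next
    fix A assume "A \<in> {A \<in> U. card (orbit ?f A) = s}"
    then show "A \<in> \<Union>?C" unfolding orbits using self[of A] by (auto simp: U)
  qed
  have "s * card ?C = card (\<Union>?C)"
  proof (rule card_partition)
    show "finite ?C" unfolding orbits using finU by simp
    show "finite (\<Union>?C)" unfolding un using finU by simp
    fix X Y assume "X \<in> ?C" "Y \<in> ?C" "X \<noteq> Y"
    then obtain A B where "A \<in> U" "B \<in> U" "X = orbit ?f A" "Y = orbit ?f B"
      unfolding orbits by auto
    then show "X \<inter> Y = {}" using \<open>X \<noteq> Y\<close> eq U by blast
  qed simp
  also have "\<dots> = size (filter_mset (\<lambda>t. fst t = s) N)"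
    unfolding un N using finU
    by (simp add: filter_mset_image_mset orbit_stats_def Let_def o_def)
  finally show "s * card {X \<in> rowmotion_orbits P r - {orbit ?f {}}. card X = s}
      = size (filter_mset (\<lambda>t. fst t = s) N)" by (simp add: X\<^sub>0_def)
qed

lemma rowmotion_orbits_Restr: "rowmotion_orbits P (Restr r P) = rowmotion_orbits P r"
proof -
  have "orbit (rowmotion P (Restr r P)) A = orbit (rowmotion P r) A" if "A \<in> antichains P r" for A
  proof (rule orbit_cong0[of _ "antichains P r"])
    show "rowmotion P (Restr r P) \<in> antichains P r \<rightarrow> antichains P r"
      using rowmotion_in_antichains[of P "Restr r P"] by (auto simp: antichains_Restr)
  qed (use that in \<open>auto simp: antichains_def rowmotion_Restr\<close>)
  then show ?thesis by (simp add: rowmotion_orbits_def antichains_Restr)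
qed

lemma chi_hat_Restr:
  assumes "X \<in> rowmotion_orbits P r"
  shows "chi_hat P (Restr r P) X = chi_hat P r X"
proof -
  have "X \<subseteq> antichains P r"
    using assms orbit_subset_if_closed[OF rowmotion_image_antichains] by (auto simp: rowmotion_orbits_def)
  then show ?thesis unfolding chi_hat_def
    by (intro sum.cong) (auto simp: antichains_def rowmotion_Restr)
qed

section \<open>Building the comb\<close>

definition comb_rel :: "comb_elt rel" where
  "comb_rel = {(x, y). comb_le x y}"

lemma partial_order_comb_rel: "partial_order_on UNIV comb_rel"
  unfolding partial_order_on_def preorder_on_def refl_on_def trans_def antisym_def comb_rel_def
  by (auto intro: comb_le_refl comb_le_antisym comb_le_trans)

lemma comb_order_eq_Restr: "k \<ge> 1 \<Longrightarrow> comb_order n k = Restr comb_rel (comb n k)"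
  by (auto simp: comb_order_iff comb_rel_def)

text \<open>The comb without its root is the more convenient object for an induction on \<open>n\<close>, since all of its
  chains have length \<open>k\<close>.\<close>

definition rootless_comb :: "nat \<Rightarrow> nat \<Rightarrow> comb_elt set" where
  "rootless_comb n k = Leaf ` {1..n + 1} \<union> (\<Union>m\<in>{2..n}. Spine m ` {1..k})"

lemma Leaf_in_rootless_comb [simp]: "Leaf i \<in> rootless_comb n k \<longleftrightarrow> 1 \<le> i \<and> i \<le> n + 1"
  by (auto simp: rootless_comb_def)

lemma Spine_in_rootless_comb [simp]:
  "Spine m j \<in> rootless_comb n k \<longleftrightarrow> 2 \<le> m \<and> m \<le> n \<and> 1 \<le> j \<and> j \<le> k"
  by (auto simp: rootless_comb_def image_iff)

lemma finite_rootless_comb: "finite (rootless_comb n k)"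
  by (simp add: rootless_comb_def)

lemma comb_eq_insert_root: "n \<ge> 1 \<Longrightarrow> comb n k = insert (Spine (n + 1) 1) (rootless_comb n k)"
proof (rule set_eqI)
  fix x assume "n \<ge> 1"
  then show "x \<in> comb n k \<longleftrightarrow> x \<in> insert (Spine (n + 1) 1) (rootless_comb n k)"
    by (cases x) (auto simp: spine_length_def)
qed

text \<open>Passing from \<open>n\<close> to \<open>n + 1\<close> puts the chain of the \<open>Spine (n + 1) j\<close> under the old forest, one minimum
  at a time and from its top down, and then adds an isolated leaf.\<close>

lemma rootless_comb_Suc:
  "n \<ge> 1 \<Longrightarrow> rootless_comb (Suc n) k =
    insert (Leaf (n + 2)) (rootless_comb n k \<union> Spine (n + 1) ` {1..k})"
proof (rule set_eqI)
  fix x assume "n \<ge> 1"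
  then show "x \<in> rootless_comb (Suc n) k \<longleftrightarrow>
      x \<in> insert (Leaf (n + 2)) (rootless_comb n k \<union> Spine (n + 1) ` {1..k})"
    by (cases x) (auto simp: image_iff)
qed

lemma rootless_comb_1: "rootless_comb (Suc 0) k = {Leaf 1, Leaf 2}"
  by (auto simp: rootless_comb_def)

lemma orbit_profile_empty: "orbit_profile {} r = ((1, 0, 0), {#})"
proof -
  have "rowmotion {} r = (\<lambda>_. {})" by (auto simp: rowmotion_def minimal_elements_def)
  moreover have "orbit (\<lambda>_. {}) {} = {{} :: 'a set}"
    by (simp add: orbit_eq_singleton_iff)
  moreover have "antichains {} r = {{}}" by (auto simp: antichains_def)
  moreover from calculation have "off_empty_orbit {} r = {}" by (auto simp: off_empty_orbit_def)
  ultimately show ?thesis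
    by (simp add: orbit_profile_def orbit_stats_def chi_def chi_hat_def down_closure_def)
qed

lemma orbit_profile_rootless_comb_1:
  "orbit_profile (rootless_comb (Suc 0) k) comb_rel = ((2, 2, 2), replicate_mset 2 (2, 2, 2))"
proof -
  have 1: "orbit_profile {Leaf 1} comb_rel = ((2, 1, 1), {#})"
    using orbit_profile_insert_isolated[OF partial_order_comb_rel _ _ _ orbit_profile_empty, of "Leaf 1"]
    by (simp add: double_stats_def)
  show ?thesis
    using orbit_profile_insert_isolated[OF partial_order_comb_rel _ _ _ 1, of "Leaf 2"]
    by (simp add: double_stats_def comb_rel_def rootless_comb_1 insert_commute)
qed

text \<open>The orbit of the empty antichain has sizes \<open>s, s + 1, \<dots>, s + j - 1\<close> when the \<open>j\<close> minima arrive; their sum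
  is what the last entry gains.\<close>

lemma orbit_profile_rootless_comb_chain:
  assumes "orbit_profile (rootless_comb n k) comb_rel = ((s, c, h), N)" "j \<le> k"
  shows "orbit_profile (rootless_comb n k \<union> Spine (n + 1) ` {k - j<..k}) comb_rel =
    ((s + j, c + j, h + real j * s + real j * (real j - 1) / 2),
     image_mset (\<lambda>(s, c, h). (s, c, h + real j * s)) N)"
  using assms(2)
proof (induction j)
  case 0
  then show ?case using assms(1) by (simp add: case_prod_beta)
next
  case (Suc j)
  let ?P = "rootless_comb n k \<union> Spine (n + 1) ` {k - j<..k}"
  have eq: "rootless_comb n k \<union> Spine (n + 1) ` {k - Suc j<..k} = insert (Spine (n + 1) (k - j)) ?P"
    using Suc.prems by (auto simp: image_iff)
  have "orbit_profile ?P comb_rel = ((s + j, c + j, h + real j * s + real j * (real j - 1) / 2),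
     image_mset (\<lambda>(s, c, h). (s, c, h + real j * s)) N)"
    using Suc by simp
  moreover have "Spine (n + 1) (k - j) \<notin> ?P" by (auto simp: rootless_comb_def)
  moreover have "(Spine (n + 1) (k - j), x) \<in> comb_rel" if "x \<in> ?P" for x
    using that by (auto simp: rootless_comb_def comb_rel_def)
  ultimately have "orbit_profile (insert (Spine (n + 1) (k - j)) ?P) comb_rel =
      ((s + j + 1, c + j + 1, h + real j * s + real j * (real j - 1) / 2 + real (s + j)),
       image_mset (\<lambda>(s, c, h). (s, c, h + s)) (image_mset (\<lambda>(s, c, h). (s, c, h + real j * s)) N))"
    by (intro orbit_profile_insert_bottom partial_order_comb_rel) (auto simp: finite_rootless_comb)
  moreover have "image_mset (\<lambda>(s, c, h). (s, c, h + s)) (image_mset (\<lambda>(s, c, h). (s, c, h + real j * s)) N)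
      = image_mset (\<lambda>(s, c, h). (s, c, h + real (Suc j) * s)) N"
    by (auto simp: multiset.map_comp o_def algebra_simps intro!: image_mset_cong)
  ultimately show ?case
    unfolding eq by (simp add: field_simps)
qed

lemma orbit_profile_rootless_comb_Suc:
  assumes "n \<ge> 1" and "orbit_profile (rootless_comb n k) comb_rel = ((s, c, h), N)"
  defines "u \<equiv> double_stats (s + k, c + k, h + real k * s + real k * (real k - 1) / 2)"
  shows "orbit_profile (rootless_comb (Suc n) k) comb_rel =
    (u, repeat_mset 2 (image_mset (\<lambda>(s, c, h). double_stats (s, c, h + real k * s)) N) +
      (if even (s + k) then replicate_mset (s + k) u else {#}))"
proof -
  let ?P = "rootless_comb n k \<union> Spine (n + 1) ` {1..k}"
  have "{k - k<..k} = {1..k}" by auto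
  then have "orbit_profile ?P comb_rel =
    ((s + k, c + k, h + real k * s + real k * (real k - 1) / 2),
     image_mset (\<lambda>(s, c, h). (s, c, h + real k * s)) N)"
    using orbit_profile_rootless_comb_chain[OF assms(2), of k] by simp
  moreover have "Leaf (n + 2) \<notin> ?P" by (auto simp: rootless_comb_def)
  moreover have "(Leaf (n + 2), x) \<notin> comb_rel \<and> (x, Leaf (n + 2)) \<notin> comb_rel" if "x \<in> ?P" for x
    using that by (auto simp: rootless_comb_def comb_rel_def)
  ultimately have "orbit_profile (insert (Leaf (n + 2)) ?P) comb_rel =
    (u, repeat_mset 2 (image_mset double_stats (image_mset (\<lambda>(s, c, h). (s, c, h + real k * s)) N)) +
      (if even (s + k) then replicate_mset (s + k) u else {#}))"
    unfolding u_def
    by (intro orbit_profile_insert_isolated partial_order_comb_rel) (auto simp: finite_rootless_comb)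
  moreover have "image_mset double_stats (image_mset (\<lambda>(s, c, h). (s, c, h + real k * s)) N) =
      image_mset (\<lambda>(s, c, h). double_stats (s, c, h + real k * s)) N"
    by (auto simp: multiset.map_comp intro!: image_mset_cong)
  ultimately show ?thesis
    unfolding rootless_comb_Suc[OF assms(1)] by simp
qed

lemma orbit_profile_comb:
  assumes "n \<ge> 1" and "orbit_profile (rootless_comb n k) comb_rel = ((s, c, h), N)"
  shows "orbit_profile (comb n k) comb_rel =
    ((s + 1, c + 1, h + s), image_mset (\<lambda>(s, c, h). (s, c, h + s)) N)"
  unfolding comb_eq_insert_root[OF assms(1)]
  by (intro orbit_profile_insert_bottom assms partial_order_comb_rel)
    (auto simp: finite_rootless_comb rootless_comb_def comb_rel_def)

section \<open>Odd chain length\<close>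

lemma repeat_replicate_mset: "repeat_mset a (replicate_mset b x) = replicate_mset (a * b) x"
  by (rule multiset_eqI) simp

section \<open>Odd\<close>

text \<open>The orbit of the empty antichain always has even size \<open>s\<close>. A chain of odd length makes it odd, so the
  next leaf doubles it to \<open>2 * (s + k)\<close> and splits nothing off. Therefore all the other orbits descend from
  the one of size \<open>2\<close> that splits off at the start, and their number doubles with each leaf. The entries of
  the triples are those of the whole comb before the root is put in. The root will add the size of the
  orbit to the last entry, so this size is subtracted here.\<close>

lemma orbit_profile_rootless_comb_odd:
  assumes "n \<ge> 1" "odd k"
  shows "orbit_profile (rootless_comb n k) comb_rel =
    (((k + 1) * 2 ^ n - 2 * k,
      ((real k + 1) * n + 1) * 2 ^ n / 2 - k,
      (2 * real k + 1) * (real k + 1) * n * 2 ^ n / 2 - (5 * (real k)\<^sup>2 + 3 * k - 3) * 2 ^ n / 2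
        + 3 * (real k)\<^sup>2 - ((real k + 1) * 2 ^ n - 2 * k)),
     replicate_mset (2 ^ n) (2, real n + 1, (2 * real k + 1) * n - 2 * k + 1))"
  using assms(1)
proof (induction n rule: dec_induct)
  case base
  then show ?case
    by (simp add: orbit_profile_rootless_comb_1 numeral_2_eq_2) (simp add: field_simps power2_eq_square)
next
  case (step n)
  define s where "s = (k + 1) * 2 ^ n - 2 * k"
  define c where "c = ((real k + 1) * n + 1) * 2 ^ n / 2 - k"
  define h where "h = (2 * real k + 1) * (real k + 1) * n * 2 ^ n / 2
    - (5 * (real k)\<^sup>2 + 3 * k - 3) * 2 ^ n / 2 + 3 * (real k)\<^sup>2 - ((real k + 1) * 2 ^ n - 2 * k)"
  note IH = step.IH[folded s_def c_def h_def]
  have le: "2 * k \<le> (k + 1) * 2 ^ n"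
  proof -
    have "(2::nat) \<le> 2 ^ n" using step.hyps by (cases n) auto
    then have "(k + 1) * 2 \<le> (k + 1) * 2 ^ n" by (rule mult_left_mono) simp
    then show ?thesis by simp
  qed
  then have rs: "real s = (real k + 1) * 2 ^ n - 2 * k"
    by (simp add: s_def of_nat_diff algebra_simps)
  have "even s" using step.hyps assms(2) by (simp add: s_def)
  then have odd: "odd (s + k)" using assms(2) by simp
  have size: "2 * (s + k) = (k + 1) * 2 ^ Suc n - 2 * k" using le by (simp add: s_def)
  have "double_stats (s + k, c + k, h + real k * s + real k * (real k - 1) / 2) =
      (2 * (s + k), 2 * (c + k + (real s + k) / 2),
       2 * (h + real k * s + real k * (real k - 1) / 2 + (real s + k) / 2))"
    unfolding double_stats_def using odd by simp
  moreover have "2 * (c + k + (real s + k) / 2) = ((real k + 1) * Suc n + 1) * 2 ^ Suc n / 2 - k"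
    unfolding c_def rs by (simp add: field_simps)
  moreover have "2 * (h + real k * s + real k * (real k - 1) / 2 + (real s + k) / 2) =
      (2 * real k + 1) * (real k + 1) * Suc n * 2 ^ Suc n / 2
      - (5 * (real k)\<^sup>2 + 3 * k - 3) * 2 ^ Suc n / 2
      + 3 * (real k)\<^sup>2 - ((real k + 1) * 2 ^ Suc n - 2 * k)"
    unfolding h_def rs by (simp add: field_simps power2_eq_square)
  moreover have "repeat_mset 2 (image_mset (\<lambda>(s, c, h). double_stats (s, c, h + real k * s))
        (replicate_mset (2 ^ n) (2, real n + 1, (2 * real k + 1) * n - 2 * k + 1))) =
      replicate_mset (2 ^ Suc n) (2, real (Suc n) + 1, (2 * real k + 1) * Suc n - 2 * k + 1)"
    by (simp add: repeat_replicate_mset double_stats_def) (simp add: field_simps)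
  ultimately show ?case
    unfolding orbit_profile_rootless_comb_Suc[OF step.hyps(1) IH] using odd by (simp only: size) simp
qed

section \<open>Even chain length\<close>

text \<open>The statistics, at stage \<open>n\<close>, of the orbits that separated from the orbit of the empty antichain at
  stage \<open>i\<close>; for \<open>i = n\<close> these are also the statistics of the orbit of the empty antichain itself. The size
  \<open>k * (i - 1) + 2\<close> does not change after the separation. The summand \<open>- s\<close> is the contribution of the
  root, which is still missing.\<close>

definition rootless_comb_stats :: "nat \<Rightarrow> nat \<Rightarrow> nat \<Rightarrow> nat \<times> real \<times> real" where
  "rootless_comb_stats k n i = (let s = k * (i - 1) + 2 in
    (s, real s / 2 * n - real k / 4 * ((real i)\<^sup>2 - 5 * i + 4) + 1,
     (2 * real k + 1) * s / 2 * n - real k * (2 * real k + 1) / 4 * (real i)\<^sup>2 + 3 * real k / 4 * i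
       + (real k - 2) * (real k - 3) / 2 - s))"

lemma image_mset_sum: "image_mset f (\<Sum>i\<in>I. M i) = (\<Sum>i\<in>I. image_mset f (M i))"
  by (induction I rule: infinite_finite_induct) auto

lemma filter_mset_sum: "filter_mset Q (\<Sum>i\<in>I. M i) = (\<Sum>i\<in>I. filter_mset Q (M i))"
  by (induction I rule: infinite_finite_induct) auto

lemma repeat_mset_sum: "repeat_mset a (\<Sum>i\<in>I. M i) = (\<Sum>i\<in>I. repeat_mset a (M i))"
  by (induction I rule: infinite_finite_induct) auto

text \<open>All orbit sizes stay even, hence every leaf splits every orbit into two copies. The orbit of the
  empty antichain gains \<open>k\<close> members from the chain and then leaves a twin behind, which founds the family
  of orbits with index \<open>n\<close>; the older families double.\<close>

lemma orbit_profile_rootless_comb_even: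
  assumes "n \<ge> 1" "even k"
  shows "orbit_profile (rootless_comb n k) comb_rel =
    (rootless_comb_stats k n n,
     \<Sum>i\<in>{1..n}. replicate_mset (2 ^ (n - i) * (k * (i - 1) + 2)) (rootless_comb_stats k n i))"
  using assms(1)
proof (induction n rule: dec_induct)
  case base
  then show ?case
    by (simp add: orbit_profile_rootless_comb_1 numeral_2_eq_2 rootless_comb_stats_def)
      (simp add: field_simps power2_eq_square)
next
  case (step n)
  obtain s c h where st: "rootless_comb_stats k n n = (s, c, h)" by (metis prod_cases3)
  have s: "s = k * (n - 1) + 2" using st by (simp add: rootless_comb_stats_def Let_def)
  then have rs: "real s = real k * (real n - 1) + 2" using step.hyps by (simp add: of_nat_diff)
  have even: "even (s + k)" "s + k = k * n + 2" using assms(2) step.hyps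
    by (cases n; simp add: s)+
  define u where "u = double_stats (s + k, c + k, h + real k * s + real k * (real k - 1) / 2)"
  have c: "c = real s / 2 * n - real k / 4 * ((real n)\<^sup>2 - 5 * n + 4) + 1"
    and h: "h = (2 * real k + 1) * s / 2 * n - real k * (2 * real k + 1) / 4 * (real n)\<^sup>2
      + 3 * real k / 4 * n + (real k - 2) * (real k - 3) / 2 - s"
    using st by (auto simp: rootless_comb_stats_def Let_def)
  have "u = (k * n + 2, c + k + real (k * n + 2) / 2,
      h + real k * s + real k * (real k - 1) / 2 + real (k * n + 2) / 2)"
    unfolding u_def double_stats_def using even by (simp add: add.assoc flip: of_nat_add)
  also have "\<dots> = rootless_comb_stats k (Suc n) (Suc n)"
    unfolding c h rs rootless_comb_stats_def Let_def by (simp add: field_simps power2_eq_square)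
  finally have u: "u = rootless_comb_stats k (Suc n) (Suc n)" .
  have old: "(\<lambda>(s, c, h). double_stats (s, c, h + real k * s)) (rootless_comb_stats k n i) =
      rootless_comb_stats k (Suc n) i" for i
    using assms(2) by (simp add: double_stats_def rootless_comb_stats_def Let_def field_simps power2_eq_square)
  have two: "2 * (2 ^ (n - i) * a) = 2 ^ (Suc n - i) * a" if "i \<in> {1..n}" for i and a :: nat
    using that by (simp add: Suc_diff_le)
  have "repeat_mset 2 (image_mset (\<lambda>(s, c, h). double_stats (s, c, h + real k * s))
      (\<Sum>i\<in>{1..n}. replicate_mset (2 ^ (n - i) * (k * (i - 1) + 2)) (rootless_comb_stats k n i))) =
      (\<Sum>i\<in>{1..n}. replicate_mset (2 ^ (Suc n - i) * (k * (i - 1) + 2)) (rootless_comb_stats k (Suc n) i))"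
    unfolding image_mset_sum repeat_mset_sum image_replicate_mset old repeat_replicate_mset
    by (intro sum.cong refl) (simp only: two)
  then show ?case
    using orbit_profile_rootless_comb_Suc[OF step.hyps(1) step.IH[unfolded st]] even u
    by (simp add: u_def)
qed

lemma filter_replicate_mset:
  "filter_mset Q (replicate_mset a x) = (if Q x then replicate_mset a x else {#})"
  by (induction a) auto

section \<open>The orbits of the comb\<close>

lemma homometric_if_card_determines:
  assumes "\<And>X. X \<in> rowmotion_orbits P r \<Longrightarrow> (card X, real (chi X), real (chi_hat P r X)) \<in> T"
    and "inj_on fst T"
  shows "homometric P r chi" "homometric P r (chi_hat P r)"
proof -
  have eq: "chi X = chi Y \<and> chi_hat P r X = chi_hat P r Y"
    if "X \<in> rowmotion_orbits P r" "Y \<in> rowmotion_orbits P r" "card X = card Y" for X Y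
    using inj_onD[OF assms(2) _ assms(1)[OF that(1)] assms(1)[OF that(2)]] that(3) by simp
  then show "homometric P r chi" "homometric P r (chi_hat P r)"
    unfolding homometric_def by blast+
qed

text \<open>The root is one more minimum. Before it arrives, all orbits have even size; it makes the size of the orbit
  of the empty antichain odd, which sets this orbit apart from all the others.\<close>

lemma orbits_of_comb_profile:
  assumes "n \<ge> 1" "k \<ge> 1" and tail: "orbit_profile (rootless_comb n k) comb_rel = ((s, c, h), N)"
    and M: "image_mset (\<lambda>(s, c, h). (s, c, h + real s)) N = M"
  defines "Orb \<equiv> rowmotion_orbits (comb n k) (comb_order n k)"
    and "ch \<equiv> chi_hat (comb n k) (comb_order n k)"
  obtains X\<^sub>0 where "X\<^sub>0 \<in> Orb" "(card X\<^sub>0, real (chi X\<^sub>0), real (ch X\<^sub>0)) = (s + 1, c + 1, h + s)"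
    and "\<forall>X \<in> Orb - {X\<^sub>0}. (card X, real (chi X), real (ch X)) \<in># M"
    and "\<forall>s. s * card {X \<in> Orb - {X\<^sub>0}. card X = s} = size (filter_mset (\<lambda>t. fst t = s) M)"
proof -
  have Orb: "Orb = rowmotion_orbits (comb n k) comb_rel"
    unfolding Orb_def comb_order_eq_Restr[OF assms(2)] by (rule rowmotion_orbits_Restr)
  have ch: "ch X = chi_hat (comb n k) comb_rel X" if "X \<in> Orb" for X
    using that unfolding ch_def comb_order_eq_Restr[OF assms(2)] Orb by (rule chi_hat_Restr)
  show ?thesis
  proof (rule orbits_of_orbit_profile[OF finite_comb partial_order_comb_rel
        orbit_profile_comb[OF assms(1) tail], unfolded M, folded Orb])
    fix X\<^sub>0
    assume X0: "X\<^sub>0 \<in> Orb"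
      and st0: "(card X\<^sub>0, real (chi X\<^sub>0), real (chi_hat (comb n k) comb_rel X\<^sub>0)) = (s + 1, c + 1, h + s)"
      and st: "\<And>X. X \<in> Orb - {X\<^sub>0} \<Longrightarrow> (card X, real (chi X), real (chi_hat (comb n k) comb_rel X)) \<in># M"
      and num: "\<And>s. s * card {X \<in> Orb - {X\<^sub>0}. card X = s} = size (filter_mset (\<lambda>t. fst t = s) M)"
    show thesis
    proof (rule that[OF X0])
      show "(card X\<^sub>0, real (chi X\<^sub>0), real (ch X\<^sub>0)) = (s + 1, c + 1, h + s)"
        using st0 by (simp only: ch[OF X0])
      show "\<forall>X \<in> Orb - {X\<^sub>0}. (card X, real (chi X), real (ch X)) \<in># M"
        using st ch by simp
      show "\<forall>s. s * card {X \<in> Orb - {X\<^sub>0}. card X = s} = size (filter_mset (\<lambda>t. fst t = s) M)"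
        using num by blast
    qed
  qed
qed

theorem theorem5p2:
  fixes n k :: nat
  assumes "n \<ge> 1" and "k \<ge> 1"
  shows
    "(odd k \<longrightarrow>
      (\<exists>S L :: comb_elt set set set.
        S \<union> L = rowmotion_orbits (comb n k) (comb_order n k) \<and> S \<inter> L = {} \<and>
        card S = 2 ^ (n - 1) \<and>
        (\<forall>X\<in>S.
          card X = 2 \<and>
          chi X = n + 1 \<and>
          real (chi_hat (comb n k) (comb_order n k) X) = (2 * real k + 1) * real n - 2 * real k + 3) \<and>
        card L = 1 \<and>
        (\<forall>X\<in>L.
          real (card X) = (real k + 1) * 2 ^ n - 2 * real k + 1 \<and>
          real (chi X) = ((real k + 1) * real n + 1) * 2 ^ (n - 1) - real k + 1 \<and>
          real (chi_hat (comb n k) (comb_order n k) X) =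
            (2 * real k + 1) * (real k + 1) * real n * 2 ^ (n - 1)
            - (5 * (real k)\<^sup>2 + 3 * real k - 3) * 2 ^ (n - 1) + 3 * (real k)\<^sup>2)))
    \<and>
    (even k \<longrightarrow>
      (\<exists>(S :: nat \<Rightarrow> comb_elt set set set) L.
        (\<Union>i\<in>{1..n}. S i) \<union> L = rowmotion_orbits (comb n k) (comb_order n k) \<and>
        disjoint_family_on S {1..n} \<and> (\<forall>i\<in>{1..n}. S i \<inter> L = {}) \<and>
        (\<forall>i\<in>{1..n}.
          card (S i) = 2 ^ (n - i) \<and>
          (\<forall>X\<in>S i.
            real (card X) = real k * (real i - 1) + 2 \<and>
            real (chi X) =
              (real k * (real i - 1) + 2) / 2 * real n
              - real k / 4 * ((real i)\<^sup>2 - 5 * real i + 4) + 1 \<and>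
            real (chi_hat (comb n k) (comb_order n k) X) =
              (2 * real k + 1) * (real k * (real i - 1) + 2) / 2 * real n
              - real k * (2 * real k + 1) / 4 * (real i)\<^sup>2 + 3 * real k / 4 * real i
              + (real k - 2) * (real k - 3) / 2)) \<and>
        card L = 1 \<and>
        (\<forall>X\<in>L.
          real (card X) = real k * (real n - 1) + 3 \<and>
          real (chi X) = real k / 4 * (real n)\<^sup>2 + (3 * real k + 4) / 4 * real n - real k + 2 \<and>
          real (chi_hat (comb n k) (comb_order n k) X) =
            real k * (2 * real k + 1) / 4 * (real n)\<^sup>2
            - (4 * (real k)\<^sup>2 - 9 * real k - 4) / 4 * real n
            + (real k - 2) * (real k - 3) / 2)))
    \<and> homometric (comb n k) (comb_order n k) chi
    \<and> homometric (comb n k) (comb_order n k) (chi_hat (comb n k) (comb_order n k))"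

proof -
  let ?Orb = "rowmotion_orbits (comb n k) (comb_order n k)"
  let ?ch = "chi_hat (comb n k) (comb_order n k)"
  let ?stats = "\<lambda>X. (card X, real (chi X), real (?ch X))"
  show ?thesis
  proof (cases "odd k")
    case True
    let ?s = "(k + 1) * 2 ^ n - 2 * k"
    let ?t = "(2, real n + 1, (2 * real k + 1) * n - 2 * k + 3) :: nat \<times> real \<times> real"
    have two: "(2::nat) \<le> 2 ^ n" using assms(1) by (cases n) auto
    then have "(k + 1) * 2 \<le> (k + 1) * 2 ^ n" by (rule mult_left_mono) simp
    then have s: "2 \<le> ?s" "real ?s = (real k + 1) * 2 ^ n - 2 * k" by (simp_all add: of_nat_diff algebra_simps)
    have pow: "(2::real) ^ n = 2 * 2 ^ (n - 1)" "(2::nat) ^ n = 2 * 2 ^ (n - 1)"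
      using assms(1) by (simp_all add: power_eq_if)
    have M: "image_mset (\<lambda>(s, c, h). (s, c, h + real s))
        (replicate_mset (2 ^ n) (2, real n + 1, (2 * real k + 1) * n - 2 * k + 1)) = replicate_mset (2 ^ n) ?t"
      by (simp add: algebra_simps)
    obtain X\<^sub>0 where X0: "X\<^sub>0 \<in> ?Orb" and
      st0: "?stats X\<^sub>0 = (?s + 1, ((real k + 1) * n + 1) * 2 ^ n / 2 - k + 1,
        (2 * real k + 1) * (real k + 1) * n * 2 ^ n / 2 - (5 * (real k)\<^sup>2 + 3 * k - 3) * 2 ^ n / 2
        + 3 * (real k)\<^sup>2 - ((real k + 1) * 2 ^ n - 2 * k) + ?s)" and
      st: "\<forall>X \<in> ?Orb - {X\<^sub>0}. ?stats X \<in># replicate_mset (2 ^ n) ?t" and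
      num: "\<forall>s. s * card {X \<in> ?Orb - {X\<^sub>0}. card X = s}
        = size (filter_mset (\<lambda>t. fst t = s) (replicate_mset (2 ^ n) ?t))"
      by (rule orbits_of_comb_profile[OF assms orbit_profile_rootless_comb_odd[OF assms(1) True] M]) (rule that; assumption)
    have stats: "?stats X = ?t" if "X \<in> ?Orb - {X\<^sub>0}" for X
      using bspec[OF st that] by simp
    have "{X \<in> ?Orb - {X\<^sub>0}. card X = 2} = ?Orb - {X\<^sub>0}" using stats by auto
    then have "2 * card (?Orb - {X\<^sub>0}) = 2 ^ n" using num[THEN spec, of 2] by (simp add: filter_replicate_mset)
    then have card: "card (?Orb - {X\<^sub>0}) = 2 ^ (n - 1)" using pow by simp
    have inj: "inj_on fst {?stats X\<^sub>0, ?t}" using st0 s(1) by auto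
    have mem: "?stats X \<in> {?stats X\<^sub>0, ?t}" if "X \<in> ?Orb" for X using stats that by auto
    note hom = homometric_if_card_determines[OF mem inj]
    have "?Orb - {X\<^sub>0} \<union> {X\<^sub>0} = ?Orb \<and> (?Orb - {X\<^sub>0}) \<inter> {X\<^sub>0} = {}" using X0 by auto
    moreover have "card X = 2 \<and> chi X = n + 1 \<and> real (?ch X) = (2 * real k + 1) * real n - 2 * real k + 3"
      if "X \<in> ?Orb - {X\<^sub>0}" for X
      using stats[OF that] by (simp flip: of_nat_Suc)
    moreover have "real (card X\<^sub>0) = (real k + 1) * 2 ^ n - 2 * real k + 1 \<and>
          real (chi X\<^sub>0) = ((real k + 1) * real n + 1) * 2 ^ (n - 1) - real k + 1 \<and>
          real (?ch X\<^sub>0) =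
            (2 * real k + 1) * (real k + 1) * real n * 2 ^ (n - 1)
            - (5 * (real k)\<^sup>2 + 3 * real k - 3) * 2 ^ (n - 1) + 3 * (real k)\<^sup>2"
      using st0 s(2) unfolding pow(1) by simp
    ultimately show ?thesis
      using True hom card by (intro conjI impI exI[of _ "?Orb - {X\<^sub>0}"] exI[of _ "{X\<^sub>0}"]) auto
  next
    case False
    then have "even k" by simp
    let ?s = "\<lambda>i. k * (i - 1) + 2"
    define t where "t i = (\<lambda>(s, c, h). (s, c, h + real s)) (rootless_comb_stats k n i)" for i
    let ?M = "\<Sum>i\<in>{1..n}. replicate_mset (2 ^ (n - i) * ?s i) (t i)"
    have fst_t: "fst (t i) = ?s i" for i by (simp add: t_def rootless_comb_stats_def Let_def)
    \<comment> \<open>The size of an orbit reveals its family, because \<open>k > 0\<close>.\<close>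
    have s_inj: "?s i = ?s j \<longleftrightarrow> i = j" if "i \<ge> 1" "j \<ge> 1" for i j
      using assms(2) that by auto
    obtain s c h where tail_n: "rootless_comb_stats k n n = (s, c, h)" by (metis prod_cases3)
    have M: "image_mset (\<lambda>(s, c, h). (s, c, h + real s))
        (\<Sum>i\<in>{1..n}. replicate_mset (2 ^ (n - i) * ?s i) (rootless_comb_stats k n i)) = ?M"
      by (simp add: image_mset_sum t_def)
    obtain X\<^sub>0 where X0: "X\<^sub>0 \<in> ?Orb" and
      st0: "?stats X\<^sub>0 = (s + 1, c + 1, h + s)" and
      st: "\<forall>X \<in> ?Orb - {X\<^sub>0}. ?stats X \<in># ?M" and
      num: "\<forall>s. s * card {X \<in> ?Orb - {X\<^sub>0}. card X = s}
        = size (filter_mset (\<lambda>t. fst t = s) ?M)"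
      by (rule orbits_of_comb_profile[OF assms
          orbit_profile_rootless_comb_even[OF assms(1) \<open>even k\<close>, unfolded tail_n] M])
        (rule that; assumption)
    have s: "s = ?s n" using tail_n by (simp add: rootless_comb_stats_def Let_def)
    have stats: "\<exists>i\<in>{1..n}. ?stats X = t i" if "X \<in> ?Orb - {X\<^sub>0}" for X
      using bspec[OF st that] by (auto simp: set_mset_sum split: if_splits)
    have stats_size: "?stats X = t i" if "X \<in> ?Orb - {X\<^sub>0}" "i \<in> {1..n}" "card X = ?s i" for X i
      using stats[OF that(1)] that s_inj fst_t by (metis atLeastAtMost_iff fst_conv)
    let ?S = "\<lambda>i. {X \<in> ?Orb - {X\<^sub>0}. card X = ?s i}"
    have card: "card (?S i) = 2 ^ (n - i)" if i: "i \<in> {1..n}" for i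
    proof -
      have "size (filter_mset (\<lambda>t. fst t = ?s i) ?M) =
          size (\<Sum>j\<in>{1..n}. if j = i then replicate_mset (2 ^ (n - j) * ?s j) (t j) else {#})"
        unfolding filter_mset_sum using i s_inj
        by (intro arg_cong[where f = size] sum.cong) (auto simp: fst_t filter_replicate_mset)
      also have "\<dots> = ?s i * 2 ^ (n - i)"
        using i by (simp add: sum.delta')
      finally have "?s i * card (?S i) = ?s i * 2 ^ (n - i)"
        by (simp only: num[THEN spec, of "?s i"])
      moreover have "?s i \<noteq> 0" by simp
      ultimately show ?thesis by (rule mult_left_cancel[THEN iffD1, rotated])
    qed
    have inj: "inj_on fst (insert (?stats X\<^sub>0) (t ` {1..n}))"
    proof -
      have "inj_on fst (t ` {1..n})" using s_inj by (auto simp: inj_on_def fst_t)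
      moreover have ne: "fst (t i) \<noteq> s + 1" for i
      proof
        assume "fst (t i) = s + 1"
        moreover have "even (fst (t i))" "odd (s + 1)"
          unfolding fst_t s using \<open>even k\<close> by simp_all
        ultimately show False by simp
      qed
      have "fst (?stats X\<^sub>0) \<notin> fst ` t ` {1..n}"
        unfolding st0 fst_conv using ne by (metis (no_types, lifting) imageE)
      ultimately show ?thesis unfolding inj_on_insert by blast
    qed
    have mem: "?stats X \<in> insert (?stats X\<^sub>0) (t ` {1..n})" if "X \<in> ?Orb" for X
      using stats that by auto
    note hom = homometric_if_card_determines[OF mem inj]
    have "(\<Union>i\<in>{1..n}. ?S i) = ?Orb - {X\<^sub>0}"
    proof (intro equalityI subsetI)
      fix X assume X: "X \<in> ?Orb - {X\<^sub>0}"
      then obtain i where "i \<in> {1..n}" "?stats X = t i" using stats by blast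
      moreover then have "card X = ?s i" using fst_t[of i] by (metis fst_conv)
      ultimately show "X \<in> (\<Union>i\<in>{1..n}. ?S i)" using X by blast
    qed blast
    then have un: "(\<Union>i\<in>{1..n}. ?S i) \<union> {X\<^sub>0} = ?Orb" using X0 by blast
    have disj: "disjoint_family_on ?S {1..n}"
      unfolding disjoint_family_on_def
    proof (intro ballI impI)
      fix i j assume "i \<in> {1..n}" "j \<in> {1..n}" "i \<noteq> j"
      then have "?s i \<noteq> ?s j" using s_inj[of i j] by simp
      then show "?S i \<inter> ?S j = {}" by auto
    qed
    have S: "real (card X) = real k * (real i - 1) + 2 \<and>
            real (chi X) =
              (real k * (real i - 1) + 2) / 2 * real n
              - real k / 4 * ((real i)\<^sup>2 - 5 * real i + 4) + 1 \<and>
            real (?ch X) =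
              (2 * real k + 1) * (real k * (real i - 1) + 2) / 2 * real n
              - real k * (2 * real k + 1) / 4 * (real i)\<^sup>2 + 3 * real k / 4 * real i
              + (real k - 2) * (real k - 3) / 2"
      if "i \<in> {1..n}" "X \<in> ?S i" for i X
      using stats_size[of X i] that
      by (simp add: t_def rootless_comb_stats_def Let_def of_nat_diff algebra_simps)
    have L: "real (card X\<^sub>0) = real k * (real n - 1) + 3 \<and>
          real (chi X\<^sub>0) = real k / 4 * (real n)\<^sup>2 + (3 * real k + 4) / 4 * real n - real k + 2 \<and>
          real (?ch X\<^sub>0) =
            real k * (2 * real k + 1) / 4 * (real n)\<^sup>2
            - (4 * (real k)\<^sup>2 - 9 * real k - 4) / 4 * real n
            + (real k - 2) * (real k - 3) / 2"
      using st0 tail_n assms(1)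
      by (auto simp: rootless_comb_stats_def Let_def of_nat_diff field_simps power2_eq_square)
    show ?thesis
    proof (rule conjI[OF impI conjI[OF impI conjI[OF hom]]], use False in simp,
        intro exI[of _ ?S] exI[of _ "{X\<^sub>0}"] conjI ballI)
    qed (rule un, rule disj, blast, erule card, use S in blast, use S in blast, use S in blast,
        simp, use L in simp, use L in simp, use L in simp)
  qed
qed

end
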